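(* Let $0 < \rho \leq \widetilde{\rho} \leq +\infty$ with $\rho < \infty$, let $0 < \epsilon \leq \widetilde{\rho} - \rho/2$, and let $p \geq 2$ be an integer. Suppose $\Lambda : (-\widetilde{\rho}, \widetilde{\rho}) \to \mathbb{R}$ is integrable, positive on $(-\rho/2,\rho/2)$, vanishes outside $[-\rho/2,\rho/2]$, and the kernel \[ [0,\epsilon) \times (-\rho/2, \rho/2 + \epsilon) \to \mathbb{R}, \qquad (x,y) \mapsto \Lambda(x-y) \] is $\mathrm{TN}_p$. Then the function $\mathcal{B}\{\Lambda\}(s) := \int_{-\rho/2}^{\rho/2} e^{-sx}\Lambda(x)\,dx$, $s \in \mathbb{C}$, has no zeros in the strip $|\operatorname{Im}(s)| < p\pi/\rho$.
   Context: For a totally ordered set $X$ and integer $r \geq 1$, $\operatorname{inc}(X,r)$ denotes the set of $r$-tuples $(x_1,\dots,x_r) \in X^r$ with $x_1 < \cdots < x_r$. For $X,Y \subset \mathbb{R}$, a kernel $K : X \times Y \to \mathbb{R}$ is $\mathrm{TN}_p$ if $\det (K(x_j,y_k))_{j,k=1}^r \geq 0$ for all $1 \leq r \leq p$ and all $\mathbf{x} \in \operatorname{inc}(X,r)$, $\mathbf{y} \in \operatorname{inc}(Y,r)$. *)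

theory Defs
  imports "HOL-Analysis.Analysis" "Jordan_Normal_Form.Determinant"
begin

definition inc :: "real set \<Rightarrow> nat \<Rightarrow> (nat \<Rightarrow> real) set" where
  "inc X r = {x. (\<forall>i<r. x i \<in> X) \<and> (\<forall>i j. i < j \<and> j < r \<longrightarrow> x i < x j)}"

definition TN :: "nat \<Rightarrow> real set \<Rightarrow> real set \<Rightarrow> (real \<Rightarrow> real \<Rightarrow> real) \<Rightarrow> bool" where
  "TN p X Y K \<longleftrightarrow>
     (\<forall>r. 1 \<le> r \<and> r \<le> p \<longrightarrow>
        (\<forall>x\<in>inc X r. \<forall>y\<in>inc Y r.
           Determinant.det (mat r r (\<lambda>(j,k). K (x j) (y k))) \<ge> 0))"

definition BL :: "real \<Rightarrow> (real \<Rightarrow> real) \<Rightarrow> complex \<Rightarrow> complex" where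
  "BL \<rho> \<Lambda> s = interval_lebesgue_integral lborel (ereal (-\<rho>/2)) (ereal (\<rho>/2))
      (\<lambda>x. exp (- s * complex_of_real x) * complex_of_real (\<Lambda> x))"

end

(* If the transform vanishes at s, with tau = |Im s| > 0, then the translates Lambda(x_j - .) for
   0 < x_1 < ... < x_p < epsilon are all orthogonal to v(y) = exp(Re s * y) sin(tau (y + rho/2)).
   When the x_j are close together these translates live on an interval of length less than
   p pi / tau, where v has at most p - 1 sign changes, at equally spaced points t_k.  Total
   nonnegativity yields a nontrivial combination w of the p translates with the same sign pattern
   as v: were all p-minors positive, one could take the determinant with columns at y, t_1, ...,
   t_{p-1}.  In general one first convolves with Gaussians, which makes all minors positive
   (Andreief's identity), and lets the width tend to 0 after normalising the coefficients.
   Then w v >= 0 while w v has integral 0, so w vanishes, which is impossible because the supports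
   of the translates begin at different points. *)
theory Submission
  imports Defs "HOL-Probability.Distributions"
begin

section \<open>Determinants of exponential and Gaussian kernels\<close>

text \<open>The obstacle is that \<open>\<Lambda>\<close> is merely integrable and its minors merely
  nonnegative. After smoothing, the sign pattern of the combination holds pointwise; what passes to
  the limit is only the sign of its pairing with bounded continuous test functions. So "w v >= 0" is
  used in weak form: w v has a nonnegative pairing with every continuous weight between 0 and 1, and
  for complementary weights \<open>g\<close> and \<open>1 - g\<close> the two pairings add up to 0.
  Strict positivity of the smoothed minors needs a strictly positive minor of the translates only on
  one open box. Such a box exists because the translates begin at different points: with the i-th
  point just to the right of where the i-th translate begins, the matrix is triangular. The bound p
  pi / \<rho> expresses that p arches of the sine, each of length pi / \<tau>, cover the support of
  length \<rho> with room to spare exactly if \<tau> < p pi / \<rho>. The spare room is what the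
  shifts x_j use up.\<close>

abbreviation fdet :: "nat \<Rightarrow> (nat \<Rightarrow> nat \<Rightarrow> real) \<Rightarrow> real" where
  "fdet n f \<equiv> Determinant.det (Matrix.mat n n (\<lambda>(i, j). f i j))"

lemma inc_UNIV_iff: "x \<in> inc UNIV n \<longleftrightarrow> (\<forall>i j. i < j \<and> j < n \<longrightarrow> x i < x j)"
  by (simp add: inc_def)

lemma fdet_leibniz:
  "fdet n f = (\<Sum>s | s permutes {0..<n}. signof s * (\<Prod>i<n. f i (s i)))"
proof -
  have "(\<Prod>i = 0..<n. Matrix.mat n n (\<lambda>(i, j). f i j) $$ (i, s i)) = (\<Prod>i<n. f i (s i))"
    if "s permutes {0..<n}" for s
  proof (rule prod.cong)
    fix i assume "i \<in> {..<n}"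
    moreover from this have "s i < n"
      using permutes_in_image[OF that, of i] by simp
    ultimately show "Matrix.mat n n (\<lambda>(i, j). f i j) $$ (i, s i) = f i (s i)" by simp
  qed auto
  then show ?thesis
    unfolding det_def'[OF mat_carrier] by (intro sum.cong refl) auto
qed

lemma fdet_cong:
  assumes "\<And>i j. i < n \<Longrightarrow> j < n \<Longrightarrow> f i j = g i j"
  shows "fdet n f = fdet n g"
  by (rule arg_cong[of _ _ Determinant.det]) (auto intro!: eq_matI simp: assms)

lemma fdet_scale:
  "fdet n (\<lambda>i j. a i * b j * f i j) = (\<Prod>i<n. a i) * (\<Prod>j<n. b j) * fdet n f"
proof -
  have "(\<Prod>i<n. a i * b (s i) * f i (s i)) = (\<Prod>i<n. a i) * (\<Prod>j<n. b j) * (\<Prod>i<n. f i (s i))"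
    if "s permutes {0..<n}" for s
  proof -
    have "(\<Prod>i<n. b (s i)) = (\<Prod>j<n. b j)"
      using prod.permute[OF that, of b] by (simp add: o_def lessThan_atLeast0)
    then show ?thesis by (simp add: prod.distrib)
  qed
  then show ?thesis
    unfolding fdet_leibniz by (simp add: sum_distrib_left algebra_simps)
qed

lemma fdet_identical_columns:
  assumes "j < k" "k < n" "\<And>i. i < n \<Longrightarrow> f i j = f i k"
  shows "fdet n f = 0"
proof -
  let ?A = "transpose_mat (Matrix.mat n n (\<lambda>(i, j). f i j))"
  have "Determinant.det ?A = 0"
  proof (rule det_identical_rows[of ?A n j k])
    show "row ?A j = row ?A k" using assms by (auto intro!: eq_vecI)
  qed (use assms in auto)
  then show ?thesis using det_transpose[of "Matrix.mat n n (\<lambda>(i, j). f i j)" n] by simp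
qed

lemma fdet_zero_column:
  assumes "k < n" "\<And>i. i < n \<Longrightarrow> f i k = 0"
  shows "fdet n f = 0"
proof -
  have "(\<Prod>i<n. f i (s i)) = 0" if s: "s permutes {0..<n}" for s
  proof -
    obtain i where "i < n" "s i = k"
      using permutes_image[OF s] assms(1) by (metis atLeastLessThan_iff imageE zero_le)
    then show ?thesis using assms(2) by (intro prod_zero) auto
  qed
  then show ?thesis unfolding fdet_leibniz by (intro sum.neutral) auto
qed

lemma fdet_upper_triangular:
  assumes "\<And>i j. j < i \<Longrightarrow> i < n \<Longrightarrow> f i j = 0"
  shows "fdet n f = (\<Prod>i<n. f i i)"
proof -
  have "fdet n f = prod_list (diag_mat (Matrix.mat n n (\<lambda>(i, j). f i j)))"
    by (rule det_upper_triangular) (auto simp: assms upper_triangular_def)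
  also have "\<dots> = (\<Prod>i<n. f i i)"
    by (subst prod_list_diag_prod) (auto simp: lessThan_atLeast0)
  finally show ?thesis .
qed

lemma fdet_expand_column:
  assumes "k < Suc n"
  shows "fdet (Suc n) f = (\<Sum>i<Suc n. f i k * ((-1) ^ (i + k) *
           fdet n (\<lambda>i' j'. f (if i' < i then i' else Suc i') (if j' < k then j' else Suc j'))))"
proof -
  let ?A = "Matrix.mat (Suc n) (Suc n) (\<lambda>(i, j). f i j)"
  have "mat_delete ?A i k = Matrix.mat n n (\<lambda>(i', j'). f (if i' < i then i' else Suc i') (if j' < k then j' else Suc j'))"
    if "i < Suc n" for i
    unfolding mat_delete_def using that assms by (auto intro!: eq_matI)
  then show ?thesis
    by (subst laplace_expansion_column[of _ "Suc n" k])
      (use assms in \<open>auto intro!: sum.cong simp: cofactor_def\<close>)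
qed

lemma fdet_mult:
  "fdet n f * fdet n (\<lambda>i j. g j i) = fdet n (\<lambda>i k. \<Sum>j<n. f i j * g k j)"
proof -
  let ?F = "Matrix.mat n n (\<lambda>(i, j). f i j)" and ?G = "Matrix.mat n n (\<lambda>(i, j). g j i)"
  have "Determinant.det ?F * Determinant.det ?G = Determinant.det (?F * ?G)"
    by (rule det_mult[symmetric, of _ n]) auto
  also have "?F * ?G = Matrix.mat n n (\<lambda>(i, k). \<Sum>j<n. f i j * g k j)"
    by (rule eq_matI) (auto simp: scalar_prod_def lessThan_atLeast0)
  finally show ?thesis .
qed

lemma fdet_transpose: "fdet n (\<lambda>i j. g j i) = fdet n g"
proof -
  have "Matrix.mat n n (\<lambda>(i, j). g j i) = transpose_mat (Matrix.mat n n (\<lambda>(i, j). g i j))"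
    by (rule eq_matI) auto
  then show ?thesis by (simp add: det_transpose[of _ n])
qed

section \<open>Strict positivity of the minors of exponential and Gaussian kernels\<close>

text \<open>Dividing by one of the exponentials and applying Rolle's theorem removes one term and one
  zero.\<close>
lemma exp_sum_zeros:
  fixes c u t :: "nat \<Rightarrow> real"
  assumes "inj_on u {..<n}" "t \<in> inc UNIV n" "\<And>k. k < n \<Longrightarrow> (\<Sum>i<n. c i * exp (u i * t k)) = 0"
  shows "\<forall>i<n. c i = 0"
  using assms
proof (induction n arbitrary: c u t)
  case 0
  then show ?case by simp
next
  case (Suc n)
  define v where "v i = u i - u n" for i
  define g where "g x = (\<Sum>i<Suc n. c i * exp (v i * x))" for x
  define g' where "g' x = (\<Sum>i<Suc n. c i * (exp (v i * x) * v i))" for x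
  have g0: "g (t k) = 0" if "k < Suc n" for k
  proof -
    have "g (t k) = (\<Sum>i<Suc n. c i * exp (u i * t k)) * exp (- u n * t k)"
      unfolding g_def v_def sum_distrib_right
      by (intro sum.cong) (auto simp: exp_add[symmetric] algebra_simps)
    then show ?thesis using Suc.prems(3)[OF that] by simp
  qed
  have der: "(g has_real_derivative g' x) (at x)" for x
    unfolding g_def g'_def by (auto intro!: derivative_eq_intros sum.cong simp: algebra_simps)
  have "\<exists>z. t k < z \<and> z < t (Suc k) \<and> g' z = 0" if "k < n" for k
  proof -
    have "\<exists>z. t k < z \<and> z < t (Suc k) \<and> DERIV g z :> 0"
    proof (rule Rolle)
      show "t k < t (Suc k)" using Suc.prems(2) that by (auto simp: inc_UNIV_iff)
      show "g (t k) = g (t (Suc k))" using g0 that by simp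
      show "continuous_on {t k..t (Suc k)} g"
        using der by (meson DERIV_isCont continuous_at_imp_continuous_on)
      show "g differentiable at x" for x using der by (meson real_differentiable_def)
    qed
    then show ?thesis using der DERIV_unique by metis
  qed
  then obtain z where z: "\<And>k. k < n \<Longrightarrow> t k < z k \<and> z k < t (Suc k) \<and> g' (z k) = 0"
    by metis
  have "z \<in> inc UNIV n"
    unfolding inc_UNIV_iff
  proof (intro allI impI)
    fix i j assume ij: "i < j \<and> j < n"
    have "t (Suc i) \<le> t j"
      using Suc.prems(2) ij by (cases "Suc i = j") (auto simp: inc_UNIV_iff less_imp_le)
    then show "z i < z j" using z[of i] z[of j] ij by fastforce
  qed
  moreover have "inj_on v {..<n}"
    using Suc.prems(1) by (auto simp: inj_on_def v_def)
  moreover have "(\<Sum>i<n. (c i * v i) * exp (v i * z k)) = 0" if "k < n" for k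
    using z[OF that] by (simp add: g'_def v_def mult_ac)
  ultimately have "\<forall>i<n. c i * v i = 0" using Suc.IH[of v z "\<lambda>i. c i * v i"] by blast
  moreover have "v i \<noteq> 0" if "i < n" for i
    using Suc.prems(1) that by (auto simp: inj_on_def v_def)
  ultimately have *: "c i = 0" if "i < n" for i using that by auto
  then have "c n = 0" using g0[of 0] by (simp add: g_def v_def)
  with * show ?case by (auto simp: less_Suc_eq)
qed

text \<open>Induction on the size. As a function \<open>F\<close> of the last node, the determinant
  is an exponential sum whose top coefficient \<open>C n\<close> is a smaller determinant, positive
  by induction. \<open>F\<close> has no zero from \<open>y n\<close> on, so its sign there is its
  sign near infinity, which is that of \<open>C n\<close>.\<close>

lemma fdet_exp_pos:
  assumes "u \<in> inc UNIV n" "y \<in> inc UNIV n"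
  shows "fdet n (\<lambda>i j. exp (u i * y j)) > 0"
  using assms
proof (induction n)
  case 0
  then show ?case by (simp add: fdet_leibniz)
next
  case (Suc n)
  define F where "F x = fdet (Suc n) (\<lambda>i j. exp (u i * (if j = n then x else y j)))" for x
  define C where "C i = (-1) ^ (i + n) * fdet n (\<lambda>i' j'. exp (u (if i' < i then i' else Suc i') * y j'))" for i
  have F: "F x = (\<Sum>i<Suc n. C i * exp (u i * x))" for x
    unfolding F_def C_def
    by (subst fdet_expand_column[of n], simp, rule sum.cong)
      (auto intro!: fdet_cong simp: mult_ac)
  have u: "u i < u j" if "i < j" "j \<le> n" for i j using Suc.prems(1) that by (auto simp: inc_UNIV_iff)
  have y: "y i < y j" if "i < j" "j \<le> n" for i j using Suc.prems(2) that by (auto simp: inc_UNIV_iff)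
  have Cn: "C n > 0"
  proof -
    have "fdet n (\<lambda>i' j'. exp (u (if i' < n then i' else Suc i') * y j')) = fdet n (\<lambda>i j. exp (u i * y j))"
      by (rule fdet_cong) auto
    moreover have "fdet n (\<lambda>i j. exp (u i * y j)) > 0"
      using Suc by (intro Suc.IH) (auto simp: inc_UNIV_iff)
    ultimately show ?thesis by (simp add: C_def)
  qed
  \<comment> \<open>\<open>F\<close> already vanishes at \<open>y 0\<close>, ...,
    \<open>y (n - 1)\<close>, where two columns coincide. One more zero would give
    \<open>n + 1\<close> zeros of a sum of \<open>n + 1\<close> exponentials and so force
    \<open>C n = 0\<close>.\<close>
  have no_zero: "F x \<noteq> 0" if x: "x \<ge> y n" for x
  proof
    assume "F x = 0"
    define t where "t k = (if k = n then x else y k)" for k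
    have "F (t k) = 0" if "k < Suc n" for k
    proof (cases "k = n")
      case False
      then show ?thesis unfolding F_def t_def using that
        by (intro fdet_identical_columns[of k n]) auto
    qed (use \<open>F x = 0\<close> in \<open>simp add: t_def\<close>)
    moreover have "t \<in> inc UNIV (Suc n)"
      unfolding inc_UNIV_iff
    proof (intro allI impI)
      fix i j assume "i < j \<and> j < Suc n"
      then show "t i < t j" using y[of i j] x by (auto simp: t_def)
    qed
    moreover have "inj_on u {..<Suc n}"
    proof (rule inj_onI)
      fix i j assume "i \<in> {..<Suc n}" "j \<in> {..<Suc n}" "u i = u j"
      then show "i = j" using u[of i j] u[of j i] by (cases i j rule: linorder_cases) auto
    qed
    ultimately have "C n = 0"
      using exp_sum_zeros[of u "Suc n" t C] unfolding F by blast
    with Cn show False by simp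
  qed
  \<comment> \<open>Dividing by the dominant exponential isolates its coefficient, since
    \<open>u i < u n\<close> for all other \<open>i\<close>.\<close>
  have lim: "((\<lambda>x. F x * exp (- u n * x)) \<longlongrightarrow> C n) at_top"
  proof -
    have eq: "F x * exp (- u n * x) = C n + (\<Sum>i<n. C i * exp ((u i - u n) * x))" for x
    proof -
      have "exp (u i * x) * exp (- u n * x) = exp ((u i - u n) * x)" for i
        by (simp add: exp_add[symmetric] algebra_simps)
      then show ?thesis
        unfolding F sum_distrib_right mult.assoc by simp
    qed
    have "((\<lambda>x. exp ((u i - u n) * x)) \<longlongrightarrow> 0) at_top" if "i < n" for i
    proof -
      have "filterlim (\<lambda>x. (u i - u n) * x) at_bot at_top"
        using u[OF that] by (intro filterlim_tendsto_neg_mult_at_bot[OF tendsto_const] filterlim_ident) auto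
      then show ?thesis by (rule filterlim_compose[OF exp_at_bot])
    qed
    then have "((\<lambda>x. C n + (\<Sum>i<n. C i * exp ((u i - u n) * x))) \<longlongrightarrow> C n + (\<Sum>i<n. C i * 0)) at_top"
      by (intro tendsto_intros) auto
    then show ?thesis unfolding eq by simp
  qed
  have "eventually (\<lambda>x. F x * exp (- u n * x) > 0) at_top"
    using order_tendstoD(1)[OF lim Cn] .
  then have "eventually (\<lambda>x. x \<ge> y n \<and> F x > 0) at_top"
    using eventually_ge_at_top[of "y n"] by eventually_elim (simp add: zero_less_mult_iff)
  then obtain x where x: "x \<ge> y n" "F x > 0"
    using eventually_happens by force
  have "F (y n) > 0"
  proof (rule ccontr)
    assume "\<not> F (y n) > 0"
    moreover have "continuous_on {y n..x} F" unfolding F by (intro continuous_intros)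
    ultimately obtain z where "y n \<le> z" "F z = 0"
      using IVT'[of F "y n" 0 x] x by auto
    with no_zero show False by auto
  qed
  also have "F (y n) = fdet (Suc n) (\<lambda>i j. exp (u i * y j))"
    unfolding F_def by (rule fdet_cong) auto
  finally show ?case .
qed

text \<open>Expanding the square turns the Gaussian kernel into an exponential kernel with rows and
  columns rescaled by positive factors.\<close>

lemma fdet_gauss_pos:
  assumes "u \<in> inc UNIV n" "y \<in> inc UNIV n" "c > 0"
  shows "fdet n (\<lambda>i j. exp (- (c * (u i - y j))\<^sup>2)) > 0"
proof -
  have "fdet n (\<lambda>i j. exp (- (c * (u i - y j))\<^sup>2)) =
      fdet n (\<lambda>i j. exp (- (c * u i)\<^sup>2) * exp (- (c * y j)\<^sup>2) * exp ((2 * c\<^sup>2 * u i) * y j))"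
    by (rule fdet_cong) (simp add: exp_add[symmetric] power2_eq_square algebra_simps)
  also have "\<dots> > 0"
    unfolding fdet_scale using assms
    by (intro mult_pos_pos prod_pos fdet_exp_pos) (auto simp: inc_UNIV_iff)
  finally show ?thesis .
qed

section \<open>The composition formula and sign patterns\<close>

text \<open>Andreief's identity. Both determinants are expanded and integrated term by term over the
  product space. The integral runs over all of R^n and not over ordered points only, whence the
  factor \<open>fact n\<close>.\<close>

lemma andreief:
  fixes f g :: "nat \<Rightarrow> real \<Rightarrow> real"
  assumes int: "\<And>i k. i < n \<Longrightarrow> k < n \<Longrightarrow> integrable lborel (\<lambda>z. f i z * g k z)"
  defines "P \<equiv> \<lambda>z. fdet n (\<lambda>i j. f i (z j)) * fdet n (\<lambda>i j. g i (z j))"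
  shows "integrable (PiM {..<n} (\<lambda>_. lborel)) P"
    and "integral\<^sup>L (PiM {..<n} (\<lambda>_. lborel)) P = fact n * fdet n (\<lambda>i k. \<integral>z. f i z * g k z \<partial>lborel)"
proof -
  interpret product_sigma_finite "\<lambda>_::nat. lborel :: real measure" ..
  let ?S = "{s. s permutes {0..<n}}"
  define M where "M i k = (\<integral>z. f i z * g k z \<partial>lborel)" for i k
  \<comment> \<open>Transposing both determinants moves the permutations from the points to the
    functions, so each term is a product of one factor per variable \<open>z i\<close> and its
    integral splits.\<close>
  have P: "P = (\<lambda>z. \<Sum>s\<in>?S. \<Sum>r\<in>?S. signof s * signof r * (\<Prod>i<n. f (s i) (z i) * g (r i) (z i)))"
    unfolding P_def
    by (subst (1 2) fdet_transpose[symmetric])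
      (simp add: fdet_leibniz sum_product prod.distrib mult_ac)
  have lt: "s i < n" if "s \<in> ?S" "i < n" for s :: "nat \<Rightarrow> nat" and i
    using permutes_in_image[of s "{0..<n}" i] that by simp
  have int': "integrable lborel (\<lambda>x. f (s i) x * g (r i) x)" if "s \<in> ?S" "r \<in> ?S" "i < n" for s r i
    using that lt by (intro int) auto
  have I: "integrable (PiM {..<n} (\<lambda>_. lborel)) (\<lambda>z. \<Prod>i<n. f (s i) (z i) * g (r i) (z i))"
    and E: "(\<integral>z. (\<Prod>i<n. f (s i) (z i) * g (r i) (z i)) \<partial>PiM {..<n} (\<lambda>_. lborel)) = (\<Prod>i<n. M (s i) (r i))"
    if "s \<in> ?S" "r \<in> ?S" for s r
  proof -
    show "integrable (PiM {..<n} (\<lambda>_. lborel)) (\<lambda>z. \<Prod>i<n. f (s i) (z i) * g (r i) (z i))"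
      by (rule product_integrable_prod) (use int'[OF that] in auto)
    show "(\<integral>z. (\<Prod>i<n. f (s i) (z i) * g (r i) (z i)) \<partial>PiM {..<n} (\<lambda>_. lborel)) = (\<Prod>i<n. M (s i) (r i))"
      unfolding M_def by (rule product_integral_prod) (use int'[OF that] in auto)
  qed
  show "integrable (PiM {..<n} (\<lambda>_. lborel)) P"
    unfolding P by (intro Bochner_Integration.integrable_sum integrable_mult_right I)
  \<comment> \<open>The inner sum is the determinant of \<open>M\<close> with rows permuted by
    \<open>s\<close>. Its sign cancels the remaining \<open>signof s\<close>, so each
    \<open>s\<close> contributes the same amount.\<close>
  have row: "(\<Sum>r\<in>?S. signof r * (\<Prod>i<n. M (s i) (r i))) = signof s * fdet n M" if "s \<in> ?S" for s
  proof -
    have "(\<Sum>r\<in>?S. signof r * (\<Prod>i<n. M (s i) (r i))) = fdet n (\<lambda>i j. M (s i) j)"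
      by (simp add: fdet_leibniz)
    also have "Matrix.mat n n (\<lambda>(i, j). M (s i) j) = Matrix.mat n n (\<lambda>(i, j). Matrix.mat n n (\<lambda>(i, j). M i j) $$ (s i, j))"
      using lt[OF that] by (auto intro!: eq_matI)
    also have "Determinant.det \<dots> = signof s * fdet n M"
      by (rule det_permute_rows) (use that in auto)
    finally show ?thesis .
  qed
  have "integral\<^sup>L (PiM {..<n} (\<lambda>_. lborel)) P =
      (\<Sum>s\<in>?S. \<Sum>r\<in>?S. signof s * signof r * (\<Prod>i<n. M (s i) (r i)))"
  proof -
    have "integral\<^sup>L (PiM {..<n} (\<lambda>_. lborel)) P =
        (\<Sum>s\<in>?S. \<integral>z. (\<Sum>r\<in>?S. signof s * signof r * (\<Prod>i<n. f (s i) (z i) * g (r i) (z i))) \<partial>PiM {..<n} (\<lambda>_. lborel))"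
      unfolding P by (intro Bochner_Integration.integral_sum Bochner_Integration.integrable_sum integrable_mult_right I)
    also have "\<dots> = (\<Sum>s\<in>?S. \<Sum>r\<in>?S. \<integral>z. signof s * signof r * (\<Prod>i<n. f (s i) (z i) * g (r i) (z i)) \<partial>PiM {..<n} (\<lambda>_. lborel))"
      by (intro sum.cong refl Bochner_Integration.integral_sum integrable_mult_right I)
    also have "\<dots> = (\<Sum>s\<in>?S. \<Sum>r\<in>?S. signof s * signof r * (\<Prod>i<n. M (s i) (r i)))"
      by (intro sum.cong refl) (simp only: integral_mult_right_zero E)
    finally show ?thesis .
  qed
  also have "\<dots> = (\<Sum>s\<in>?S. signof s * (\<Sum>r\<in>?S. signof r * (\<Prod>i<n. M (s i) (r i))))"
    by (simp add: sum_distrib_left mult_ac)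
  also have "\<dots> = (\<Sum>s\<in>?S. signof s * (signof s * fdet n M))"
    by (intro sum.cong) (simp_all add: row)
  also have "\<dots> = (\<Sum>s\<in>?S. fdet n M)"
    by (intro sum.cong) (auto simp: sign_def)
  also have "\<dots> = fact n * fdet n M"
    using card_permutations[of "{0..<n}" n] by simp
  finally show "integral\<^sup>L (PiM {..<n} (\<lambda>_. lborel)) P = fact n * fdet n (\<lambda>i k. \<integral>z. f i z * g k z \<partial>lborel)"
    by (simp add: M_def)
qed

lemma ex_sorting_permutation:
  fixes z :: "nat \<Rightarrow> real"
  obtains s where "s permutes {..<n}" "\<And>i j. i < j \<Longrightarrow> j < n \<Longrightarrow> z (s i) \<le> z (s j)"
proof -
  let ?xs = "map z [0..<n]"
  obtain s where s: "s permutes {..<length ?xs}" "permute_list s ?xs = sort ?xs"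
    using mset_eq_permutation[of "sort ?xs" ?xs] by (metis mset_sort)
  have s': "s permutes {..<n}" using s(1) by simp
  have lt: "s i < n" if "i < n" for i
    using permutes_in_image[OF s', of i] that by simp
  have nth: "sort ?xs ! i = z (s i)" if "i < n" for i
    using that lt[OF that] by (simp add: s(2)[symmetric] permute_list_def)
  have "z (s i) \<le> z (s j)" if "i < j" "j < n" for i j
    using sorted_nth_mono[of "sort ?xs" i j] that nth[of i] nth[of j] by simp
  with s' show thesis by (rule that)
qed

text \<open>The product of the two determinants is itself a determinant whose entries are symmetric in
  the points \<open>z j\<close>.\<close>
lemma fdet_product_permute:
  assumes "s permutes {..<n}"
  shows "fdet n (\<lambda>i j. f i (z (s j))) * fdet n (\<lambda>i j. g i (z (s j))) =
         fdet n (\<lambda>i j. f i (z j)) * fdet n (\<lambda>i j. g i (z j))"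
proof -
  have *: "fdet n (\<lambda>i j. f i (w j)) * fdet n (\<lambda>i j. g i (w j)) =
      fdet n (\<lambda>i k. \<Sum>j<n. f i (w j) * g k (w j))" for w
    by (subst (2) fdet_transpose[symmetric]) (rule fdet_mult)
  have "(\<Sum>j<n. f i (z (s j)) * g k (z (s j))) = (\<Sum>j<n. f i (z j) * g k (z j))" for i k
    using sum.permute[OF assms, of "\<lambda>j. f i (z j) * g k (z j)"] by (simp add: o_def)
  then show ?thesis
    using *[of "\<lambda>j. z (s j)"] *[of z] by simp
qed

text \<open>The product does not change when the points are sorted. Sorted points are either
  strictly increasing, where both factors are nonnegative, or contain a tie, which gives equal
  columns. Thus the integrand of Andreief's identity is nonnegative everywhere.\<close>

lemma fdet_product_nonneg:
  fixes z :: "nat \<Rightarrow> real"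
  assumes f: "\<And>z. z \<in> inc UNIV n \<Longrightarrow> fdet n (\<lambda>i j. f i (z j)) \<ge> 0"
    and g: "\<And>z. z \<in> inc UNIV n \<Longrightarrow> fdet n (\<lambda>i j. g i (z j)) \<ge> 0"
  shows "fdet n (\<lambda>i j. f i (z j)) * fdet n (\<lambda>i j. g i (z j)) \<ge> 0"
proof -
  obtain s where s: "s permutes {..<n}" and mono: "\<And>i j. i < j \<Longrightarrow> j < n \<Longrightarrow> z (s i) \<le> z (s j)"
    using ex_sorting_permutation by blast
  have "fdet n (\<lambda>i j. f i (z (s j))) * fdet n (\<lambda>i j. g i (z (s j))) \<ge> 0"
  proof (cases "(\<lambda>j. z (s j)) \<in> inc UNIV n")
    case True
    then show ?thesis using f g by (intro mult_nonneg_nonneg) auto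
  next
    case False
    then obtain i j where "i < j" "j < n" "z (s i) = z (s j)"
      using mono by (auto simp: inc_UNIV_iff) (meson leD le_less not_le)
    then have "fdet n (\<lambda>i j. f i (z (s j))) = 0"
      by (intro fdet_identical_columns[of i j]) auto
    then show ?thesis by simp
  qed
  then show ?thesis using fdet_product_permute[OF s, of f z g] by simp
qed

text \<open>By Andreief's identity the determinant is, up to \<open>fact n\<close>, the integral of
  a nonnegative function. If it were 0, the integrand would vanish almost everywhere, but it is
  positive on an open box of positive measure.\<close>

lemma fdet_composition_pos:
  fixes f g :: "nat \<Rightarrow> real \<Rightarrow> real"
  assumes int: "\<And>i k. i < n \<Longrightarrow> k < n \<Longrightarrow> integrable lborel (\<lambda>z. f i z * g k z)"
    and f: "\<And>z. z \<in> inc UNIV n \<Longrightarrow> fdet n (\<lambda>i j. f i (z j)) \<ge> 0"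
    and g: "\<And>z. z \<in> inc UNIV n \<Longrightarrow> fdet n (\<lambda>i j. g i (z j)) \<ge> 0"
    and lu: "\<And>i. i < n \<Longrightarrow> l i < (u i :: real)"
    and pos: "\<And>z. (\<And>i. i < n \<Longrightarrow> l i < z i \<and> z i < u i) \<Longrightarrow>
                fdet n (\<lambda>i j. f i (z j)) * fdet n (\<lambda>i j. g i (z j)) > 0"
  shows "fdet n (\<lambda>i k. \<integral>z. f i z * g k z \<partial>lborel) > 0"
proof -
  interpret product_sigma_finite "\<lambda>_::nat. lborel :: real measure" ..
  let ?M = "PiM {..<n} (\<lambda>_. lborel :: real measure)"
  define P where "P z = fdet n (\<lambda>i j. f i (z j)) * fdet n (\<lambda>i j. g i (z j))" for z
  have I: "integrable ?M P" and E: "integral\<^sup>L ?M P = fact n * fdet n (\<lambda>i k. \<integral>z. f i z * g k z \<partial>lborel)"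
    using andreief[OF int] by (simp_all add: P_def[abs_def])
  have P0: "P z \<ge> 0" for z
    unfolding P_def by (rule fdet_product_nonneg[OF f g])
  let ?B = "PiE {..<n} (\<lambda>i. {l i<..<u i})"
  have "integral\<^sup>L ?M P \<noteq> 0"
  proof
    assume "integral\<^sup>L ?M P = 0"
    then have "AE z in ?M. P z = 0"
      using integral_nonneg_eq_0_iff_AE[OF I] P0 by simp
    then have "AE z in ?M. z \<notin> ?B"
    proof eventually_elim
      case (elim z)
      then show ?case using pos[of z] by (auto simp: P_def PiE_iff)
    qed
    moreover have "?B \<in> sets ?M"
      by (rule sets_PiM_I_finite) auto
    ultimately have "emeasure ?M ?B = 0"
      using AE_iff_null_sets by blast
    moreover have "emeasure ?M ?B = (\<Prod>i<n. emeasure lborel {l i<..<u i})"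
      by (rule emeasure_PiM) auto
    moreover have "emeasure lborel {l i<..<u i} \<noteq> 0" if "i < n" for i
      using lu[OF that] by simp
    ultimately show False by simp
  qed
  moreover have "integral\<^sup>L ?M P \<ge> 0" using P0 by (rule Bochner_Integration.integral_nonneg)
  ultimately have "0 < fact n * fdet n (\<lambda>i k. \<integral>z. f i z * g k z \<partial>lborel)"
    unfolding E by linarith
  then show ?thesis by (rule zero_less_mult_pos) simp
qed

section \<open>Combinations with prescribed sign changes\<close>

text \<open>\<open>y\<close> lies in the \<open>i\<close>-th of the \<open>m + 1\<close> open gaps cut out by \<open>t 0 < \<dots> < t (m - 1)\<close>; the
  first and the last gap are unbounded.\<close>
definition in_gap :: "nat \<Rightarrow> (nat \<Rightarrow> real) \<Rightarrow> nat \<Rightarrow> real \<Rightarrow> bool" where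
  "in_gap m t i y \<longleftrightarrow> i \<le> m \<and> (\<forall>k<m. if k < i then t k < y else y < t k)"

text \<open>Used for a sequence of kernels. The normalisation keeps the coefficient vectors in a
  compact set that does not contain 0, so that a limit point exists and is nontrivial.\<close>

lemma ex_sign_vector:
  assumes t: "t \<in> inc UNIV m"
    and pos: "\<And>y. y \<in> inc UNIV (Suc m) \<Longrightarrow> fdet (Suc m) (\<lambda>i j. K i (y j)) > 0"
  shows "\<exists>c. (\<Sum>i\<le>m. \<bar>c i\<bar>) = 1 \<and> (\<forall>k y. in_gap m t k y \<longrightarrow> (-1) ^ k * (\<Sum>i\<le>m. c i * K i y) > 0)"
proof -
  \<comment> \<open>Cofactors along the column of \<open>y\<close>: deleting that column leaves the columns \<open>t j\<close>, whatever
    gap \<open>y\<close> lies in, so the gap enters only through the sign.\<close>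
  define c where "c i = (-1) ^ i * fdet m (\<lambda>i' j'. K (if i' < i then i' else Suc i') (t j'))" for i
  have main: "(-1) ^ k * (\<Sum>i\<le>m. c i * K i y) > 0" if "in_gap m t k y" for k y
  proof -
    have k: "k \<le> m" and lt: "\<And>j. j < k \<Longrightarrow> t j < y" and gt: "\<And>j. k \<le> j \<Longrightarrow> j < m \<Longrightarrow> y < t j"
      using that by (auto simp: in_gap_def split: if_splits)
    \<comment> \<open>\<open>Y\<close> inserts \<open>y\<close> at position \<open>k\<close> among
      the \<open>t j\<close>. It is increasing because \<open>y\<close> lies in gap
      \<open>k\<close>, and expansion along column \<open>k\<close> produces the sign
      \<open>(-1) ^ k\<close>.\<close>
    define Y where "Y j = (if j < k then t j else if j = k then y else t (j - 1))" for j
    have "Y \<in> inc UNIV (Suc m)"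
      unfolding inc_UNIV_iff
    proof (intro allI impI)
      fix i j assume ij: "i < j \<and> j < Suc m"
      have tt: "t a < t b" if "a < b" "b < m" for a b
        using t that by (auto simp: inc_UNIV_iff)
      show "Y i < Y j"
        unfolding Y_def using ij k lt[of i] gt[of "j - 1"] tt[of i j] tt[of i "j - 1"] tt[of "i - 1" "j - 1"]
        by auto
    qed
    then have "0 < fdet (Suc m) (\<lambda>i j. K i (Y j))" by (rule pos)
    also have "\<dots> = (\<Sum>i<Suc m. K i y * ((-1) ^ (i + k) * fdet m (\<lambda>i' j'. K (if i' < i then i' else Suc i') (t j'))))"
      by (subst fdet_expand_column[of k], use k in simp, rule sum.cong)
        (auto simp: Y_def intro!: fdet_cong)
    also have "\<dots> = (-1) ^ k * (\<Sum>i\<le>m. c i * K i y)"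
      unfolding c_def sum_distrib_left lessThan_Suc_atMost
      by (intro sum.cong) (auto simp: power_add mult_ac)
    finally show ?thesis .
  qed
  define S where "S = (\<Sum>i\<le>m. \<bar>c i\<bar>)"
  have "S \<noteq> 0"
  proof
    assume "S = 0"
    then have "\<forall>i\<le>m. c i = 0" by (simp add: S_def sum_nonneg_eq_0_iff)
    \<comment> \<open>A point to the left of all \<open>t k\<close>, where the strict inequality
      excludes the zero vector. The inserted 0 keeps \<open>Min\<close> defined when
      \<open>m = 0\<close>.\<close>
    moreover have "in_gap m t 0 (Min (insert 0 (t ` {..<m})) - 1)"
    proof -
      have "Min (insert 0 (t ` {..<m})) \<le> t k" if "k < m" for k using that by (intro Min_le) auto
      then have "Min (insert 0 (t ` {..<m})) - 1 < t k" if "k < m" for k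
        using that by (smt (verit))
      then show ?thesis by (simp add: in_gap_def)
    qed
    ultimately show False using main by fastforce
  qed
  moreover have "S \<ge> 0" unfolding S_def by (rule sum_nonneg) simp
  ultimately have S: "S > 0" by simp
  show ?thesis
  proof (intro exI conjI allI impI)
    show "(\<Sum>i\<le>m. \<bar>c i / S\<bar>) = 1"
      using S by (simp add: S_def[symmetric] sum_divide_distrib[symmetric] abs_divide)
    fix k y assume "in_gap m t k y"
    from main[OF this] S show "(-1) ^ k * (\<Sum>i\<le>m. c i / S * K i y) > 0"
      by (simp add: sum_divide_distrib[symmetric])
  qed
qed

section \<open>Gaussian smoothing\<close>

lemma has_bochner_integral_gauss:
  "has_bochner_integral lborel (\<lambda>x::real. exp (- x\<^sup>2)) (sqrt pi)"
  using has_bochner_integral_even_function[OF gaussian_moment_0] by simp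

lemma
  fixes N :: real
  assumes "N > 0"
  shows integrable_gauss_kernel: "integrable lborel (\<lambda>y. exp (- (N * (z - y))\<^sup>2))"
    and integral_gauss_kernel: "(\<integral>y. exp (- (N * (z - y))\<^sup>2) \<partial>lborel) = sqrt pi / N"
proof -
  have g: "integrable lborel (\<lambda>x::real. exp (- x\<^sup>2))" "(\<integral>x. exp (- x\<^sup>2) \<partial>lborel) = sqrt pi"
    using has_bochner_integral_gauss by (simp_all add: has_bochner_integral_iff)
  show "integrable lborel (\<lambda>y. exp (- (N * (z - y))\<^sup>2))"
    using lborel_integrable_real_affine[OF g(1), of "- N" "N * z"] assms by (simp add: algebra_simps)
  show "(\<integral>y. exp (- (N * (z - y))\<^sup>2) \<partial>lborel) = sqrt pi / N"
    using lborel_integral_real_affine[of "- N" "\<lambda>x. exp (- x\<^sup>2)" "N * z"] assms g(2)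
    by (simp add: field_simps)
qed

text \<open>Fubini moves the Gaussian from \<open>f\<close> to the test function \<open>h\<close>,
  and the substitution \<open>y = z + u / N\<close> moves the width into the argument of
  \<open>h\<close>. As \<open>N\<close> grows, only continuity of \<open>h\<close> is then at stake,
  while \<open>f\<close> stays merely integrable. The factor \<open>N\<close> makes the Gaussian
  mass independent of \<open>N\<close>.\<close>

lemma
  fixes f h :: "real \<Rightarrow> real"
  assumes f: "integrable lborel f" and h[measurable]: "h \<in> borel_measurable borel"
    and B: "\<And>y. \<bar>h y\<bar> \<le> B" and N: "N > 0"
  shows integrable_gauss_smoothing:
      "integrable lborel (\<lambda>y. h y * (\<integral>z. f z * exp (- (N * (z - y))\<^sup>2) \<partial>lborel))"
    and integral_gauss_smoothing:
      "(\<integral>y. h y * (N * (\<integral>z. f z * exp (- (N * (z - y))\<^sup>2) \<partial>lborel)) \<partial>lborel) =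
       (\<integral>z. f z * (\<integral>u. h (z + u / N) * exp (- u\<^sup>2) \<partial>lborel) \<partial>lborel)"
proof -
  have f'[measurable]: "f \<in> borel_measurable borel" using f by (simp add: borel_measurable_integrable)
  define F where "F z y = f z * exp (- (N * (z - y))\<^sup>2)" for z y
  have F: "integrable (lborel \<Otimes>\<^sub>M lborel) (\<lambda>(z, y). F z y)"
  proof (rule lborel_pair.Fubini_integrable)
    show "(\<lambda>(z, y). F z y) \<in> borel_measurable (lborel \<Otimes>\<^sub>M lborel)"
      unfolding F_def by measurable
    show "integrable lborel (\<lambda>x. \<integral>y. norm (case (x, y) of (z, y) \<Rightarrow> F z y) \<partial>lborel)"
      using f by (simp add: F_def abs_mult integral_gauss_kernel[OF N])
    show "AE x in lborel. integrable lborel (\<lambda>y. case (x, y) of (z, y) \<Rightarrow> F z y)"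
      by (simp add: F_def integrable_gauss_kernel[OF N])
  qed
  have hF: "integrable (lborel \<Otimes>\<^sub>M lborel) (\<lambda>(z, y). h y * F z y)"
  proof (rule Bochner_Integration.integrable_bound)
    show "integrable (lborel \<Otimes>\<^sub>M lborel) (\<lambda>x. B * (\<lambda>(z, y). F z y) x)"
      using F by (rule integrable_mult_right)
    show "(\<lambda>(z, y). h y * F z y) \<in> borel_measurable (lborel \<Otimes>\<^sub>M lborel)"
      unfolding F_def by measurable
    show "AE x in lborel \<Otimes>\<^sub>M lborel. norm ((\<lambda>(z, y). h y * F z y) x) \<le> norm (B * (\<lambda>(z, y). F z y) x)"
    proof (intro AE_I2)
      fix x :: "real \<times> real"
      have "\<bar>h (snd x)\<bar> * \<bar>F (fst x) (snd x)\<bar> \<le> \<bar>B\<bar> * \<bar>F (fst x) (snd x)\<bar>"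
        by (rule mult_right_mono) (use B[of "snd x"] in auto)
      then show "norm ((\<lambda>(z, y). h y * F z y) x) \<le> norm (B * (\<lambda>(z, y). F z y) x)"
        by (simp add: abs_mult case_prod_unfold)
    qed
  qed
  show "integrable lborel (\<lambda>y. h y * (\<integral>z. f z * exp (- (N * (z - y))\<^sup>2) \<partial>lborel))"
    using lborel_pair.integrable_snd[OF hF] by (simp add: F_def)
  have "(\<integral>y. h y * (N * (\<integral>z. F z y \<partial>lborel)) \<partial>lborel) = N * (\<integral>y. (\<integral>z. h y * F z y \<partial>lborel) \<partial>lborel)"
    by (simp add: mult.left_commute)
  also have "\<dots> = N * (\<integral>z. (\<integral>y. h y * F z y \<partial>lborel) \<partial>lborel)"
    by (subst lborel_pair.Fubini_integral[OF hF]) (rule refl)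
  also have "\<dots> = (\<integral>z. N * (\<integral>y. h y * F z y \<partial>lborel) \<partial>lborel)" by simp
  also have "\<dots> = (\<integral>z. f z * (\<integral>u. h (z + u / N) * exp (- u\<^sup>2) \<partial>lborel) \<partial>lborel)"
  proof (rule Bochner_Integration.integral_cong[OF refl])
    fix z
    have "(\<integral>y. h y * F z y \<partial>lborel) = f z * (\<integral>y. h y * exp (- (N * (z - y))\<^sup>2) \<partial>lborel)"
      unfolding F_def by (simp add: mult.left_commute)
    also have "(\<integral>y. h y * exp (- (N * (z - y))\<^sup>2) \<partial>lborel) = (1 / N) * (\<integral>u. h (z + u / N) * exp (- u\<^sup>2) \<partial>lborel)"
      using lborel_integral_real_affine[of "1 / N" "\<lambda>y. h y * exp (- (N * (z - y))\<^sup>2)" z] N by simp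
    finally show "N * (\<integral>y. h y * F z y \<partial>lborel) = f z * (\<integral>u. h (z + u / N) * exp (- u\<^sup>2) \<partial>lborel)"
      using N by simp
  qed
  finally show "(\<integral>y. h y * (N * (\<integral>z. f z * exp (- (N * (z - y))\<^sup>2) \<partial>lborel)) \<partial>lborel) =
       (\<integral>z. f z * (\<integral>u. h (z + u / N) * exp (- u\<^sup>2) \<partial>lborel) \<partial>lborel)"
    by (simp add: F_def)
qed

text \<open>Dominated convergence twice: inside, with a multiple of the Gaussian as majorant and
  continuity of \<open>h\<close> for the pointwise limit; outside, with a multiple of
  \<open>\<bar>f z\<bar>\<close>.\<close>

lemma gauss_smoothing_tendsto:
  fixes f h :: "real \<Rightarrow> real"
  assumes f: "integrable lborel f" and h: "continuous_on UNIV h" and B: "\<And>y. \<bar>h y\<bar> \<le> B"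
  shows "(\<lambda>n. \<integral>y. h y * (real (Suc n) * (\<integral>z. f z * exp (- (real (Suc n) * (z - y))\<^sup>2) \<partial>lborel)) \<partial>lborel)
           \<longlonglongrightarrow> sqrt pi * (\<integral>z. f z * h z \<partial>lborel)"
proof -
  have [measurable]: "f \<in> borel_measurable borel" using f by (simp add: borel_measurable_integrable)
  have [measurable]: "h \<in> borel_measurable borel" using h by (rule borel_measurable_continuous_onI)
  have g: "integrable lborel (\<lambda>x::real. exp (- x\<^sup>2))" "(\<integral>x. exp (- x\<^sup>2) \<partial>lborel) = sqrt pi"
    using has_bochner_integral_gauss by (simp_all add: has_bochner_integral_iff)
  define H where "H n z = (\<integral>u. h (z + u / real (Suc n)) * exp (- u\<^sup>2) \<partial>lborel)" for n z
  have bd: "\<bar>h y * exp (- u\<^sup>2)\<bar> \<le> B * exp (- u\<^sup>2)" for y u :: real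
    using B[of y] by (simp add: abs_mult mult_right_mono)
  have Hm[measurable]: "H n \<in> borel_measurable borel" for n
    unfolding H_def by measurable
  have lim: "(\<lambda>n. H n z) \<longlonglongrightarrow> sqrt pi * h z" for z
  proof -
    have "(\<lambda>n. H n z) \<longlonglongrightarrow> (\<integral>u. h z * exp (- u\<^sup>2) \<partial>lborel)"
      unfolding H_def
    proof (rule integral_dominated_convergence[where w = "\<lambda>u. B * exp (- u\<^sup>2)"])
      show "integrable lborel (\<lambda>u. B * exp (- u\<^sup>2))" using g(1) by simp
      show "AE u in lborel. norm (h (z + u / real (Suc n)) * exp (- u\<^sup>2)) \<le> B * exp (- u\<^sup>2)" for n
        using bd by simp
      show "AE u in lborel. (\<lambda>n. h (z + u / real (Suc n)) * exp (- u\<^sup>2)) \<longlonglongrightarrow> h z * exp (- u\<^sup>2)"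
      proof (intro AE_I2 tendsto_mult tendsto_const)
        fix u :: real
        have "(\<lambda>n. z + u / real (Suc n)) \<longlonglongrightarrow> z + 0"
          by (intro tendsto_add tendsto_const LIMSEQ_Suc[OF lim_const_over_n])
        moreover have "isCont h z" using h by (simp add: continuous_on_eq_continuous_at)
        ultimately show "(\<lambda>n. h (z + u / real (Suc n))) \<longlonglongrightarrow> h z"
          using isCont_tendsto_compose[of z h] by simp
      qed
    qed measurable
    then show ?thesis using g(2) by (simp add: mult.commute)
  qed
  have Hb: "\<bar>H n z\<bar> \<le> B * sqrt pi" for n z
  proof -
    have "\<bar>H n z\<bar> \<le> (\<integral>u. B * exp (- u\<^sup>2) \<partial>lborel)"
      unfolding H_def real_norm_def[symmetric]
    proof (rule order_trans[OF integral_norm_bound], rule Bochner_Integration.integral_mono)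
      show "integrable lborel (\<lambda>u. B * exp (- u\<^sup>2))" using g(1) by simp
      then show "integrable lborel (\<lambda>u. norm (h (z + u / real (Suc n)) * exp (- u\<^sup>2)))"
        by (rule Bochner_Integration.integrable_bound) (auto intro!: AE_I2 order_trans[OF bd])
    qed (use bd in auto)
    then show ?thesis using g(2) by simp
  qed
  have "(\<lambda>n. \<integral>z. f z * H n z \<partial>lborel) \<longlonglongrightarrow> (\<integral>z. f z * (sqrt pi * h z) \<partial>lborel)"
  proof (rule integral_dominated_convergence[where w = "\<lambda>z. \<bar>f z\<bar> * (B * sqrt pi)"])
    show "integrable lborel (\<lambda>z. \<bar>f z\<bar> * (B * sqrt pi))" using f by simp
    show "AE z in lborel. norm (f z * H n z) \<le> \<bar>f z\<bar> * (B * sqrt pi)" for n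
      using Hb by (simp add: abs_mult mult_left_mono)
    show "AE z in lborel. (\<lambda>n. f z * H n z) \<longlonglongrightarrow> f z * (sqrt pi * h z)"
      by (intro AE_I2 tendsto_mult tendsto_const lim)
  qed measurable
  moreover have "(\<integral>z. f z * (sqrt pi * h z) \<partial>lborel) = sqrt pi * (\<integral>z. f z * h z \<partial>lborel)"
    by (simp add: mult.left_commute)
  ultimately show ?thesis
    by (subst integral_gauss_smoothing[OF f _ B]) (simp_all add: H_def)
qed

section \<open>Passage to the limit of vanishing Gaussian width\<close>

lemma ex_coordinatewise_convergent_subseq:
  fixes c :: "nat \<Rightarrow> nat \<Rightarrow> real"
  assumes "\<And>n j. j < p \<Longrightarrow> \<bar>c n j\<bar> \<le> B"
  shows "\<exists>l r. strict_mono (r :: nat \<Rightarrow> nat) \<and> (\<forall>j<p. (\<lambda>n. c (r n) j) \<longlonglongrightarrow> l j)"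
  using assms
proof (induction p)
  case 0
  then show ?case using strict_mono_id by (auto simp: id_def)
next
  case (Suc p)
  from Suc obtain l r where r: "strict_mono (r :: nat \<Rightarrow> nat)" and l: "\<forall>j<p. (\<lambda>n. c (r n) j) \<longlonglongrightarrow> l j"
    by (metis less_Suc_eq)
  have "bounded (range (\<lambda>n. c (r n) p))"
    using Suc.prems[of p] by (auto simp: bounded_iff)
  then obtain a s where s: "strict_mono (s :: nat \<Rightarrow> nat)" and a: "((\<lambda>n. c (r n) p) \<circ> s) \<longlonglongrightarrow> a"
    using bounded_imp_convergent_subsequence by blast
  have "(\<lambda>n. c (r (s n)) j) \<longlonglongrightarrow> (l(p := a)) j" if "j < Suc p" for j
  proof (cases "j = p")
    case False
    then have "(\<lambda>n. c (r n) j) \<longlonglongrightarrow> l j" using that l by simp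
    from LIMSEQ_subseq_LIMSEQ[OF this s] False show ?thesis by (simp add: o_def)
  qed (use a in \<open>simp add: o_def\<close>)
  moreover have "strict_mono (\<lambda>n. r (s n))" using r s by (simp add: strict_mono_def)
  ultimately show ?case by blast
qed

text \<open>Weak form of the sign pattern: the combination of the \<open>f i\<close> with
  coefficients \<open>c\<close> pairs nonnegatively with every admissible \<open>h\<close>, and
  \<open>c\<close> does not depend on \<open>h\<close>. No gap contains a point \<open>t k\<close>
  with \<open>k < m\<close>, so an admissible \<open>h\<close> vanishes there.\<close>

lemma ex_sign_functional:
  fixes f :: "nat \<Rightarrow> real \<Rightarrow> real" and t l u :: "nat \<Rightarrow> real"
  assumes int: "\<And>i. i \<le> m \<Longrightarrow> integrable lborel (f i)"
    and f: "\<And>z. z \<in> inc UNIV (Suc m) \<Longrightarrow> fdet (Suc m) (\<lambda>i j. f i (z j)) \<ge> 0"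
    and lu: "\<And>i. i \<le> m \<Longrightarrow> l i < u i"
    and pos: "\<And>z. (\<And>i. i \<le> m \<Longrightarrow> l i < z i \<and> z i < u i) \<Longrightarrow>
                z \<in> inc UNIV (Suc m) \<and> fdet (Suc m) (\<lambda>i j. f i (z j)) > 0"
    and t: "t \<in> inc UNIV m"
  obtains c where "\<exists>i\<le>m. c i \<noteq> 0"
    and "\<And>h B. \<lbrakk>continuous_on UNIV h; \<And>y. \<bar>h y\<bar> \<le> B;
           \<And>y. h y = 0 \<or> (\<exists>k. in_gap m t k y \<and> (-1) ^ k * h y \<ge> 0)\<rbrakk>
           \<Longrightarrow> 0 \<le> (\<Sum>i\<le>m. c i * (\<integral>y. f i y * h y \<partial>lborel))"
proof -
  define K where "K n i y = (\<integral>z. f i z * exp (- (real (Suc n) * (z - y))\<^sup>2) \<partial>lborel)" for n i y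
  have "fdet (Suc m) (\<lambda>i k. K n i (y k)) > 0" if y: "y \<in> inc UNIV (Suc m)" for n y
    unfolding K_def
  proof (rule fdet_composition_pos[where l = l and u = u])
    have gp: "fdet (Suc m) (\<lambda>i j. exp (- (real (Suc n) * (z j - y i))\<^sup>2)) > 0" if "z \<in> inc UNIV (Suc m)" for z
      using fdet_gauss_pos[OF that y, of "real (Suc n)"]
      by (subst fdet_transpose[symmetric]) simp
    then show "fdet (Suc m) (\<lambda>i j. exp (- (real (Suc n) * (z j - y i))\<^sup>2)) \<ge> 0" if "z \<in> inc UNIV (Suc m)" for z
      using that by (simp add: less_imp_le)
    show "fdet (Suc m) (\<lambda>i j. f i (z j)) * fdet (Suc m) (\<lambda>i j. exp (- (real (Suc n) * (z j - y i))\<^sup>2)) > 0"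
      if "\<And>i. i < Suc m \<Longrightarrow> l i < z i \<and> z i < u i" for z
      using gp[of z] pos[of z] that by (intro mult_pos_pos) auto
    show "integrable lborel (\<lambda>z. f i z * exp (- (real (Suc n) * (z - y k))\<^sup>2))" if "i < Suc m" for i k
    proof (rule Bochner_Integration.integrable_bound)
      show "integrable lborel (f i)" using int that by simp
      then have [measurable]: "f i \<in> borel_measurable borel" by (simp add: borel_measurable_integrable)
      show "(\<lambda>z. f i z * exp (- (real (Suc n) * (z - y k))\<^sup>2)) \<in> borel_measurable lborel" by measurable
      show "AE z in lborel. norm (f i z * exp (- (real (Suc n) * (z - y k))\<^sup>2)) \<le> norm (f i z)"
        by (intro AE_I2) (simp add: abs_mult mult_left_le)
    qed
  qed (use f lu in auto)
  then have "\<forall>n. \<exists>c. (\<Sum>i\<le>m. \<bar>c i\<bar>) = 1 \<and>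
      (\<forall>k y. in_gap m t k y \<longrightarrow> (-1) ^ k * (\<Sum>i\<le>m. c i * K n i y) > 0)"
    using ex_sign_vector[OF t, of "K _"] by blast
  then obtain c where c1: "\<And>n. (\<Sum>i\<le>m. \<bar>c n i\<bar>) = 1"
    and c: "\<And>n k y. in_gap m t k y \<Longrightarrow> (-1) ^ k * (\<Sum>i\<le>m. c n i * K n i y) > 0"
    by metis
  have "\<bar>c n j\<bar> \<le> 1" if "j < Suc m" for n j
    using member_le_sum[of j "{..m}" "\<lambda>i. \<bar>c n i\<bar>"] c1[of n] that by simp
  then obtain a r where r: "strict_mono (r :: nat \<Rightarrow> nat)"
    and a: "\<And>j. j \<le> m \<Longrightarrow> (\<lambda>n. c (r n) j) \<longlonglongrightarrow> a j"
    using ex_coordinatewise_convergent_subseq[of "Suc m" c 1] by (metis less_Suc_eq_le)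
  show thesis
  proof (rule that)
    \<comment> \<open>The normalisation survives the limit, which makes the limit vector
      nonzero.\<close>
    have "(\<lambda>n. \<Sum>i\<le>m. \<bar>c (r n) i\<bar>) \<longlonglongrightarrow> (\<Sum>i\<le>m. \<bar>a i\<bar>)"
      by (intro tendsto_intros a) auto
    then have "(\<Sum>i\<le>m. \<bar>a i\<bar>) = 1" unfolding c1 by (simp add: LIMSEQ_const_iff)
    then show "\<exists>i\<le>m. a i \<noteq> 0"
      by (metis (mono_tags, lifting) abs_zero atMost_iff sum.neutral zero_neq_one)
  next
    fix h :: "real \<Rightarrow> real" and B
    assume h: "continuous_on UNIV h" and B: "\<And>y. \<bar>h y\<bar> \<le> B"
      and sgn: "\<And>y. h y = 0 \<or> (\<exists>k. in_gap m t k y \<and> (-1) ^ k * h y \<ge> 0)"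
    have [measurable]: "h \<in> borel_measurable borel" using h by (rule borel_measurable_continuous_onI)
    \<comment> \<open>The kernels \<open>K n\<close> are not normalised; the factor
      \<open>real (Suc n)\<close> gives the pairings a finite limit and, being positive, does not
      affect signs.\<close>
    define I where "I n i = (\<integral>y. h y * (real (Suc n) * K n i y) \<partial>lborel)" for n i
    have lim: "(\<lambda>n. I n i) \<longlonglongrightarrow> sqrt pi * (\<integral>z. f i z * h z \<partial>lborel)" if "i \<le> m" for i
      unfolding I_def K_def using gauss_smoothing_tendsto[OF int[OF that] h B] .
    have Kint: "integrable lborel (\<lambda>y. h y * K n i y)" if "i \<le> m" for n i
      unfolding K_def by (rule integrable_gauss_smoothing[OF int[OF that] _ B]) auto
    have nonneg: "(\<Sum>i\<le>m. c n i * I n i) \<ge> 0" for n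
    proof -
      have "(\<Sum>i\<le>m. c n i * I n i) = (\<Sum>i\<le>m. \<integral>y. (c n i * real (Suc n)) * (h y * K n i y) \<partial>lborel)"
        unfolding I_def integral_mult_right_zero[symmetric]
        by (intro sum.cong refl Bochner_Integration.integral_cong) (simp add: mult_ac)
      also have "\<dots> = (\<integral>y. (\<Sum>i\<le>m. (c n i * real (Suc n)) * (h y * K n i y)) \<partial>lborel)"
        by (rule Bochner_Integration.integral_sum[symmetric]) (use Kint in auto)
      also have "\<dots> = (\<integral>y. real (Suc n) * (h y * (\<Sum>i\<le>m. c n i * K n i y)) \<partial>lborel)"
        by (simp add: sum_distrib_left mult_ac)
      also have "\<dots> \<ge> 0"
      proof (rule Bochner_Integration.integral_nonneg, rule mult_nonneg_nonneg)
        fix y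
        show "h y * (\<Sum>i\<le>m. c n i * K n i y) \<ge> 0"
        proof (cases "h y = 0")
          case False
          then obtain k where k: "in_gap m t k y" "(-1) ^ k * h y \<ge> 0" using sgn by blast
          \<comment> \<open>In gap \<open>k\<close> both factors carry the sign
            \<open>(-1) ^ k\<close>, and the two signs cancel in the product.\<close>
          have "0 \<le> ((-1) ^ k * h y) * ((-1) ^ k * (\<Sum>i\<le>m. c n i * K n i y))"
            by (rule mult_nonneg_nonneg[OF k(2) less_imp_le[OF c[OF k(1)]]])
          also have "\<dots> = h y * (\<Sum>i\<le>m. c n i * K n i y)"
            by (cases "even k") auto
          finally show ?thesis .
        qed simp
      qed auto
      finally show ?thesis .
    qed
    have "(\<lambda>n. \<Sum>i\<le>m. c (r n) i * I (r n) i) \<longlonglongrightarrow> (\<Sum>i\<le>m. a i * (sqrt pi * (\<integral>z. f i z * h z \<partial>lborel)))"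
      using LIMSEQ_subseq_LIMSEQ[OF lim r] by (intro tendsto_intros a) (auto simp: o_def)
    then have "(\<Sum>i\<le>m. a i * (sqrt pi * (\<integral>z. f i z * h z \<partial>lborel))) \<ge> 0"
      by (rule tendsto_lowerbound) (use nonneg in auto)
    also have "(\<Sum>i\<le>m. a i * (sqrt pi * (\<integral>z. f i z * h z \<partial>lborel))) = sqrt pi * (\<Sum>i\<le>m. a i * (\<integral>y. f i y * h y \<partial>lborel))"
      by (simp add: sum_distrib_left mult.left_commute)
    finally show "0 \<le> (\<Sum>i\<le>m. a i * (\<integral>y. f i y * h y \<partial>lborel))"
      using pi_gt_zero by (auto simp: zero_le_mult_iff)
  qed
qed

section \<open>Zeros of the Laplace transform\<close>

text \<open>A continuous \<open>k\<close> is bounded on the compact interval outside which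
  \<open>L\<close> vanishes. Scalar multiplication covers real and complex \<open>k\<close> at
  once.\<close>

lemma integrable_scaleR_continuous:
  fixes L :: "real \<Rightarrow> real" and k :: "real \<Rightarrow> 'b :: {banach, second_countable_topology}"
  assumes L: "integrable lborel L" "\<And>x. x \<notin> {a..b} \<Longrightarrow> L x = 0" and k: "continuous_on UNIV k"
  shows "integrable lborel (\<lambda>x. L x *\<^sub>R k x)"
proof -
  have [measurable]: "L \<in> borel_measurable borel" using L by (simp add: borel_measurable_integrable)
  have [measurable]: "k \<in> borel_measurable borel" using k by (rule borel_measurable_continuous_onI)
  have "compact (k ` {a..b})"
    using k by (intro compact_continuous_image) (auto intro: continuous_on_subset)
  then obtain B where B: "\<And>x. x \<in> {a..b} \<Longrightarrow> norm (k x) \<le> B"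
    using compact_imp_bounded bounded_iff by (metis image_eqI)
  show ?thesis
  proof (rule Bochner_Integration.integrable_bound)
    show "integrable lborel (\<lambda>x. \<bar>B\<bar> * L x)" using L(1) by simp
    show "AE x in lborel. norm (L x *\<^sub>R k x) \<le> norm (\<bar>B\<bar> * L x)"
    proof (intro AE_I2)
      fix x show "norm (L x *\<^sub>R k x) \<le> norm (\<bar>B\<bar> * L x)"
      proof (cases "x \<in> {a..b}")
        case True
        from B[OF this] have "norm (k x) \<le> \<bar>B\<bar>" by simp
        from mult_left_mono[OF this, of "\<bar>L x\<bar>"] show ?thesis by (simp add: abs_mult mult.commute)
      qed (use L(2) in auto)
    qed
  qed simp
qed

lemma integral_pos_of_pos_on_interval:
  fixes g :: "real \<Rightarrow> real"
  assumes g: "integrable lborel g" "\<And>x. g x \<ge> 0" and ab: "a < b" "\<And>x. a < x \<Longrightarrow> x < b \<Longrightarrow> g x > 0"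
  shows "(\<integral>x. g x \<partial>lborel) > 0"
proof -
  have "(\<integral>x. g x \<partial>lborel) \<noteq> 0"
  proof
    assume "(\<integral>x. g x \<partial>lborel) = 0"
    then have "AE x in lborel. g x = 0"
      using integral_nonneg_eq_0_iff_AE[OF g(1)] g(2) by simp
    then have "AE x in lborel. x \<notin> {a<..<b}"
      by eventually_elim (use ab(2) in force)
    then have "{a<..<b} \<in> null_sets lborel"
      by (subst AE_iff_null_sets) auto
    then show False using ab(1) by (simp add: null_sets_def)
  qed
  moreover have "(\<integral>x. g x \<partial>lborel) \<ge> 0"
    using g(2) by (rule Bochner_Integration.integral_nonneg)
  ultimately show ?thesis by simp
qed

lemma sin_sign:
  assumes "real k * pi \<le> x" "x \<le> (real k + 1) * pi"
  shows "(-1) ^ k * sin x \<ge> 0"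
proof -
  have "sin x = sin ((x - real k * pi) + real k * pi)" by simp
  also have "\<dots> = sin (x - real k * pi) * (-1) ^ k"
    unfolding sin_add by simp
  finally have "(-1) ^ k * sin x = sin (x - real k * pi)" by simp
  also have "\<dots> \<ge> 0" using assms by (intro sin_ge_zero) (auto simp: algebra_simps)
  finally show ?thesis .
qed

text \<open>\<open>cos0\<close> and \<open>sin0\<close> are the real part and, up to sign, the
  imaginary part of the vanishing transform at \<sigma> + i \<tau>. By the addition theorem they
  make the function \<open>e\<close> below orthogonal to all reflected translates of
  \<open>L\<close>.\<close>

lemma laplace_zero_contradiction:
  fixes L :: "real \<Rightarrow> real" and \<rho> \<epsilon> \<sigma> \<tau> :: real
  assumes \<rho>: "0 < \<rho>" and \<epsilon>: "0 < \<epsilon>" and p: "1 \<le> p"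
    and int: "integrable lborel L"
    and pos: "\<And>x. -\<rho>/2 < x \<Longrightarrow> x < \<rho>/2 \<Longrightarrow> L x > 0"
    and zero: "\<And>x. x \<notin> {-\<rho>/2..\<rho>/2} \<Longrightarrow> L x = 0"
    and TN: "\<And>x y. x \<in> inc {0..<\<epsilon>} p \<Longrightarrow> y \<in> inc {-\<rho>/2<..<\<rho>/2+\<epsilon>} p \<Longrightarrow>
               fdet p (\<lambda>i j. L (x i - y j)) \<ge> 0"
    and \<tau>: "0 < \<tau>" "\<tau> * \<rho> < real p * pi"
    and cos0: "(\<integral>x. L x * (exp (- \<sigma> * x) * cos (\<tau> * x)) \<partial>lborel) = 0"
    and sin0: "(\<integral>x. L x * (exp (- \<sigma> * x) * sin (\<tau> * x)) \<partial>lborel) = 0"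
  shows False
proof -
  obtain m where m: "p = Suc m" using p by (cases p) auto
  \<comment> \<open>\<open>d\<close> is the spacing of the zeros of the sine, \<open>a\<close> the
    left end of the support, and \<open>b\<close> the \<open>p\<close>-th zero after
    \<open>a\<close>.\<close>
  define d where "d = pi / \<tau>"
  define a where "a = -\<rho>/2"
  define b where "b = a + real p * d"
  have d: "d > 0" "\<rho> < real p * d" using \<tau> by (simp_all add: d_def field_simps)
  \<comment> \<open>Shifts up to \<open>M\<close> satisfy four demands: \<epsilon> keeps them in the
    range of the hypothesis on minors, \<open>d\<close> keeps the boxes below in the first arch of
    the sine, \<rho> keeps each box inside the support of its translate, and
    \<open>real p * d - \<rho>\<close> keeps all supports in \<open>[a, b]\<close>.\<close>
  define M where "M = min (min \<epsilon> d) (min \<rho> (real p * d - \<rho>))"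
  \<comment> \<open>\<open>p\<close> steps of length \<eta> reach the last shift; two more steps
    remain as a margin below \<open>M\<close>.\<close>
  define \<eta> where "\<eta> = M / (real p + 2)"
  have M: "M > 0" "M \<le> \<epsilon>" "M \<le> d" "M \<le> \<rho>" "M \<le> real p * d - \<rho>"
    using \<rho> \<epsilon> d by (auto simp: M_def)
  have "(real p + 2) * \<eta> = M" by (simp add: \<eta>_def)
  then have "real p * \<eta> + 2 * \<eta> = M" by (simp add: distrib_right)
  moreover have "\<eta> > 0" using M(1) by (simp add: \<eta>_def)
  ultimately have \<eta>: "\<eta> > 0" "real p * \<eta> + 2 * \<eta> = M" by auto
  \<comment> \<open>Starting at \<eta> and not at 0 makes \<open>f i\<close> vanish also at
    \<open>a\<close>: its value there is \<open>L (x i + \<rho>/2)\<close>, whereas nothing is known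
    about \<open>L\<close> at \<open>\<rho>/2\<close> itself.\<close>
  define x where "x i = (real i + 1) * \<eta>" for i
  have x_pos: "0 < x i" for i using \<eta>(1) by (simp add: x_def)
  have x_le: "x i \<le> M - 2 * \<eta>" if "i \<le> m" for i
  proof -
    have "x i \<le> real p * \<eta>" unfolding x_def using that \<eta>(1) m by (intro mult_right_mono) auto
    then show ?thesis using \<eta>(2) by simp
  qed
  have x_Suc: "x i + \<eta> \<le> x j" if "i < j" for i j
  proof -
    have "(real i + 1 + 1) * \<eta> \<le> (real j + 1) * \<eta>" using that \<eta>(1) by (intro mult_right_mono) auto
    then show ?thesis by (simp add: x_def algebra_simps)
  qed
  have \<eta>_le: "\<eta> \<le> M" using x_le[of 0] x_pos[of 0] \<eta>(1) by simp
  define f where "f i y = L (x i - y)" for i y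
  have f_zero: "f i y = 0" if "y < x i + a \<or> y > x i - a" for i y
    unfolding f_def by (rule zero) (use that in \<open>auto simp: a_def\<close>)
  have f_pos: "f i y > 0" if "x i + a < y" "y < x i - a" for i y
    unfolding f_def by (rule pos) (use that in \<open>auto simp: a_def\<close>)
  have f_int: "integrable lborel (f i)" for i
    using lborel_integrable_real_affine[OF int, of "-1" "x i"] by (simp add: f_def[abs_def])
  have f_TN: "fdet (Suc m) (\<lambda>i j. f i (z j)) \<ge> 0" if z: "z \<in> inc UNIV (Suc m)" for z
  proof (cases "\<forall>j\<le>m. z j \<in> {-\<rho>/2<..<\<rho>/2+\<epsilon>}")
    case True
    have "x \<in> inc {0..<\<epsilon>} p"
      unfolding inc_def
    proof (intro CollectI conjI allI impI)
      fix i assume "i < p"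
      then show "x i \<in> {0..<\<epsilon>}" using x_le[of i] x_pos[of i] M(2) \<eta>(1) m by simp
    next
      fix i j assume "i < j \<and> j < p"
      then show "x i < x j" using x_Suc[of i j] \<eta>(1) by simp
    qed
    moreover have "z \<in> inc {-\<rho>/2<..<\<rho>/2+\<epsilon>} p"
      using True z m by (auto simp: inc_def less_Suc_eq_le)
    ultimately show ?thesis using TN[of x z] by (simp add: f_def m)
  next
    case False
    then obtain k where k: "k \<le> m" "z k \<le> -\<rho>/2 \<or> z k \<ge> \<rho>/2 + \<epsilon>"
      by (auto simp: not_less)
    \<comment> \<open>A point outside the window of the hypothesis lies outside the support of every
      translate, so its column is zero.\<close>
    have "f i (z k) = 0" if "i \<le> m" for i
      by (rule f_zero) (use k(2) x_pos[of i] x_le[OF that] M(2) \<eta>(1) in \<open>auto simp: a_def\<close>)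
    then show ?thesis using k(1) by (subst fdet_zero_column[of k]) auto
  qed
  \<comment> \<open>\<open>l i\<close> is where the \<open>i\<close>-th translate begins. The
    intervals from \<open>l i\<close> to \<open>u i\<close> are disjoint and ordered.\<close>
  define l where "l i = x i + a" for i
  define u where "u i = l i + \<eta>" for i
  have lu: "l i < u i" for i using \<eta>(1) by (simp add: u_def)
  have ul: "u i \<le> l j" if "i < j" for i j using x_Suc[OF that] by (simp add: u_def l_def)
  have f_box: "z \<in> inc UNIV (Suc m) \<and> fdet (Suc m) (\<lambda>i j. f i (z j)) > 0"
    if z: "\<And>i. i \<le> m \<Longrightarrow> l i < z i \<and> z i < u i" for z
  proof
    show "z \<in> inc UNIV (Suc m)"
      unfolding inc_UNIV_iff
    proof (intro allI impI)
      fix i j assume "i < j \<and> j < Suc m"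
      then show "z i < z j" using z[of i] z[of j] ul[of i j] by simp
    qed
    \<comment> \<open>For \<open>j < i\<close> the point \<open>z j\<close> lies before the start of
      \<open>f i\<close>, so the entries below the diagonal vanish, while those on it are
      positive.\<close>
    have "fdet (Suc m) (\<lambda>i j. f i (z j)) = (\<Prod>i<Suc m. f i (z i))"
    proof (rule fdet_upper_triangular)
      fix i j assume "j < i" "i < Suc m"
      then show "f i (z j) = 0" using z[of j] ul[of j i] by (intro f_zero) (simp add: l_def)
    qed
    also have "\<dots> > 0"
    proof (intro prod_pos ballI f_pos)
      fix i assume "i \<in> {..<Suc m}"
      then show "x i + a < z i" "z i < x i - a"
        using z[of i] \<eta>_le M(4) by (simp_all add: l_def u_def a_def)
    qed
    finally show "fdet (Suc m) (\<lambda>i j. f i (z j)) > 0" .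
  qed
  \<comment> \<open>The \<open>m = p - 1\<close> zeros of the sine strictly between \<open>a\<close>
    and \<open>b\<close>; the summand 1 skips the zero at \<open>a\<close>.\<close>
  define t where "t k = a + (real k + 1) * d" for k
  have t: "t \<in> inc UNIV m" using d(1) by (simp add: inc_UNIV_iff t_def)
  obtain c where c: "\<exists>i\<le>m. c i \<noteq> 0"
    and c_nonneg: "\<And>h B. \<lbrakk>continuous_on UNIV h; \<And>y. \<bar>h y\<bar> \<le> B;
           \<And>y. h y = 0 \<or> (\<exists>k. in_gap m t k y \<and> (-1) ^ k * h y \<ge> 0)\<rbrakk>
           \<Longrightarrow> 0 \<le> (\<Sum>i\<le>m. c i * (\<integral>y. f i y * h y \<partial>lborel))"
    using ex_sign_functional[of m f l u t, OF f_int f_TN lu f_box t] by blast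

  define e where "e y = exp (\<sigma> * y) * sin (\<tau> * (y - a))" for y
  \<comment> \<open>\<open>e\<close> vanishes at both ends of \<open>[a, b]\<close>, so \<open>V\<close> is \<open>e\<close> cut off to \<open>[a, b]\<close>.\<close>
  define V where "V y = e (max a (min b y))" for y
  have ab: "a \<le> b" using d by (simp add: b_def)
  have e_ends: "e a = 0" "e b = 0"
    using \<tau>(1) by (simp_all add: e_def b_def d_def)
  have V_eq: "V y = e y" if "a \<le> y" "y \<le> b" for y using that by (simp add: V_def)
  have V_zero: "V y = 0" if "y \<le> a \<or> b \<le> y" for y
    using that ab e_ends by (auto simp: V_def max_def min_def)
  have V_cont: "continuous_on UNIV V"
    unfolding V_def e_def by (intro continuous_intros)
  obtain B where B: "\<And>y. \<bar>V y\<bar> \<le> B"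
  proof
    fix y
    define w where "w = max a (min b y)"
    have "\<bar>w\<bar> \<le> \<bar>a\<bar> + \<bar>b\<bar>" by (auto simp: w_def)
    then have "\<bar>\<sigma>\<bar> * \<bar>w\<bar> \<le> \<bar>\<sigma>\<bar> * (\<bar>a\<bar> + \<bar>b\<bar>)" by (rule mult_left_mono) simp
    moreover have "\<sigma> * w \<le> \<bar>\<sigma>\<bar> * \<bar>w\<bar>" by (simp add: abs_mult[symmetric])
    ultimately have "exp (\<sigma> * w) * \<bar>sin (\<tau> * (w - a))\<bar> \<le> exp (\<bar>\<sigma>\<bar> * (\<bar>a\<bar> + \<bar>b\<bar>)) * 1"
      by (intro mult_mono) auto
    then show "\<bar>V y\<bar> \<le> exp (\<bar>\<sigma>\<bar> * (\<bar>a\<bar> + \<bar>b\<bar>))"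
      by (simp add: V_def e_def w_def abs_mult)
  qed
  have V_sign: "V y = 0 \<or> (\<exists>k. in_gap m t k y \<and> (-1) ^ k * V y \<ge> 0)" for y
  proof (rule disjCI)
    assume neg: "\<not> (\<exists>k. in_gap m t k y \<and> (-1) ^ k * V y \<ge> 0)"
    show "V y = 0"
    proof (rule ccontr)
      assume V: "V y \<noteq> 0"
      then have y: "a < y" "y < b" using V_zero[of y] by force+
      \<comment> \<open>The index of the arch that contains \<open>y\<close>; \<open>y < b\<close>
        forces \<open>k \<le> m\<close>.\<close>
      define k where "k = nat \<lfloor>(y - a) / d\<rfloor>"
      have "real k = of_int \<lfloor>(y - a) / d\<rfloor>" using y(1) d(1) by (simp add: k_def)
      then have "real k \<le> (y - a) / d" "(y - a) / d < real k + 1" by linarith+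
      then have k: "real k * d \<le> y - a" "y - a < (real k + 1) * d"
        using d(1) by (simp_all add: field_simps)
      have "real k * d < real p * d" using k(1) y(2) by (simp add: b_def)
      then have km: "k \<le> m" using d(1) m by simp
      \<comment> \<open>The floor allows \<open>y\<close> to be the left end of its arch. This must
        be excluded, because gaps are open, and it is, because \<open>V\<close> vanishes
        there.\<close>
      have ne: "y - a \<noteq> real k * d"
      proof
        assume "y - a = real k * d"
        then have "\<tau> * (y - a) = real k * pi" using \<tau>(1) by (simp add: d_def)
        then have "sin (\<tau> * (y - a)) = 0" by (simp only: sin_npi)
        with V y show False by (simp add: V_eq e_def)
      qed
      have gap: "in_gap m t k y"
        unfolding in_gap_def
      proof (intro conjI allI impI)
        fix j assume "j < m"
        show "if j < k then t j < y else y < t j"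
        proof (cases "j < k")
          case True
          then have "(real j + 1) * d \<le> real k * d" using d(1) by (intro mult_right_mono) auto
          then show ?thesis using True k(1) ne by (simp add: t_def)
        next
          case False
          then have "(real k + 1) * d \<le> (real j + 1) * d" using d(1) by (intro mult_right_mono) auto
          then show ?thesis using False k(2) by (simp add: t_def)
        qed
      qed (rule km)
      have "(-1) ^ k * sin (\<tau> * (y - a)) \<ge> 0"
      proof (rule sin_sign)
        show "real k * pi \<le> \<tau> * (y - a)" "\<tau> * (y - a) \<le> (real k + 1) * pi"
          using mult_left_mono[OF k(1), of \<tau>] mult_left_mono[OF less_imp_le[OF k(2)], of \<tau>] \<tau>(1)
          by (simp_all add: d_def)
      qed
      then have "exp (\<sigma> * y) * ((-1) ^ k * sin (\<tau> * (y - a))) \<ge> 0"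
        by (rule mult_nonneg_nonneg[OF exp_ge_zero])
      then have "(-1) ^ k * V y \<ge> 0"
        using y by (simp add: V_eq e_def mult.left_commute)
      with neg gap show False by blast
    qed
  qed

  \<comment> \<open>Orthogonality of \<open>V\<close> to the translates\<close>
  have fV: "(\<integral>y. f i y * V y \<partial>lborel) = 0" if "i \<le> m" for i
  proof -
    have kint: "integrable lborel (\<lambda>u. L u * k u)" if "continuous_on UNIV k" for k :: "real \<Rightarrow> real"
    proof -
      have "integrable lborel (\<lambda>u. L u *\<^sub>R k u)"
        by (intro integrable_scaleR_continuous[OF int zero] that)
      then show ?thesis by simp
    qed
    have "(\<integral>y. f i y * V y \<partial>lborel) = (\<integral>y. f i y * e y \<partial>lborel)"
    proof (rule Bochner_Integration.integral_cong[OF refl])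
      fix y
      show "f i y * V y = f i y * e y"
      proof (cases "x i + a \<le> y \<and> y \<le> x i - a")
        case True
        then have "a \<le> y" "y \<le> b"
          using x_pos[of i] x_le[OF that] M(5) \<eta>(1) by (auto simp: b_def a_def)
        then show ?thesis by (simp add: V_eq)
      next
        case False
        then show ?thesis using f_zero[of y i] by auto
      qed
    qed
    also have "\<dots> = (\<integral>u. L u * e (x i - u) \<partial>lborel)"
      using lborel_integral_real_affine[of "-1" "\<lambda>y. f i y * e y" "x i"] by (simp add: f_def)
    also have "\<dots> = (\<integral>u. exp (\<sigma> * x i) * sin (\<tau> * (x i - a)) * (L u * (exp (- \<sigma> * u) * cos (\<tau> * u))) -
        exp (\<sigma> * x i) * cos (\<tau> * (x i - a)) * (L u * (exp (- \<sigma> * u) * sin (\<tau> * u))) \<partial>lborel)"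
    proof (rule Bochner_Integration.integral_cong[OF refl])
      fix u
      have "sin (\<tau> * (x i - u - a)) = sin (\<tau> * (x i - a) - \<tau> * u)" by (simp add: algebra_simps)
      moreover have "exp (\<sigma> * (x i - u)) = exp (\<sigma> * x i) * exp (- \<sigma> * u)"
        by (simp add: exp_add[symmetric] algebra_simps)
      ultimately have E: "e (x i - u) = exp (\<sigma> * x i) * exp (- \<sigma> * u) *
          (sin (\<tau> * (x i - a)) * cos (\<tau> * u) - cos (\<tau> * (x i - a)) * sin (\<tau> * u))"
        by (simp add: e_def sin_diff)
      show "L u * e (x i - u) = exp (\<sigma> * x i) * sin (\<tau> * (x i - a)) * (L u * (exp (- \<sigma> * u) * cos (\<tau> * u))) -
        exp (\<sigma> * x i) * cos (\<tau> * (x i - a)) * (L u * (exp (- \<sigma> * u) * sin (\<tau> * u)))"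
        unfolding E by (simp only: right_diff_distrib mult_ac)
    qed
    also have "\<dots> = exp (\<sigma> * x i) * sin (\<tau> * (x i - a)) * 0 - exp (\<sigma> * x i) * cos (\<tau> * (x i - a)) * 0"
    proof (subst Bochner_Integration.integral_diff)
      show "integrable lborel (\<lambda>u. exp (\<sigma> * x i) * sin (\<tau> * (x i - a)) * (L u * (exp (- \<sigma> * u) * cos (\<tau> * u))))"
        by (intro integrable_mult_right kint continuous_intros)
      show "integrable lborel (\<lambda>u. exp (\<sigma> * x i) * cos (\<tau> * (x i - a)) * (L u * (exp (- \<sigma> * u) * sin (\<tau> * u))))"
        by (intro integrable_mult_right kint continuous_intros)
    qed (simp only: integral_mult_right_zero cos0 sin0)
    finally show ?thesis by simp
  qed

  \<comment> \<open>Localisation at the first translate with nonzero coefficient\<close>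
  define j where "j = (LEAST j. j \<le> m \<and> c j \<noteq> 0)"
  have j: "j \<le> m" "c j \<noteq> 0" using LeastI_ex[OF c] by (auto simp: j_def)
  have c_below: "c i = 0" if "i < j" for i
    using not_less_Least[of i "\<lambda>j. j \<le> m \<and> c j \<noteq> 0"] that j(1) by (auto simp: j_def)
  \<comment> \<open>A tent on \<open>(l j, u j)\<close>, where among the translates with nonzero coefficient only \<open>f j\<close> is
    nonzero.\<close>
  define g where "g y = max 0 (1 - \<bar>y - (l j + \<eta>/2)\<bar> / (\<eta>/2))" for y
  have g01: "0 \<le> g y" "g y \<le> 1" for y using \<eta>(1) by (auto simp: g_def)
  have g_cont: "continuous_on UNIV g" unfolding g_def using \<eta>(1) by (intro continuous_intros) auto
  have g_pos: "g y > 0" if "l j < y" "y < u j" for y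
  proof -
    have "\<bar>y - (l j + \<eta>/2)\<bar> < \<eta>/2" using that unfolding u_def abs_less_iff by linarith
    then show ?thesis using \<eta>(1) by (simp add: g_def)
  qed
  have g_zero: "g y = 0" if "y \<le> l j \<or> u j \<le> y" for y
  proof -
    have "\<bar>y - (l j + \<eta>/2)\<bar> \<ge> \<eta>/2" using that unfolding u_def by linarith
    then have "\<bar>y - (l j + \<eta>/2)\<bar> / (\<eta>/2) \<ge> 1" using \<eta>(1) by simp
    then show ?thesis by (simp add: g_def)
  qed
  \<comment> \<open>A weight between 0 and 1 does not disturb the sign pattern of \<open>V\<close>.
    Applied to \<open>g\<close> and to \<open>1 - g\<close>, this gives two nonnegative numbers
    whose sum is 0 by \<open>fV\<close>, so the pairing localised by \<open>g\<close> is 0.\<close>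
  have weighted: "0 \<le> (\<Sum>i\<le>m. c i * (\<integral>y. f i y * (V y * w y) \<partial>lborel))"
    if w: "continuous_on UNIV w" "\<And>y. 0 \<le> w y" "\<And>y. w y \<le> 1" for w
  proof (rule c_nonneg)
    show "continuous_on UNIV (\<lambda>y. V y * w y)" using V_cont w(1) by (intro continuous_intros)
    show "\<bar>V y * w y\<bar> \<le> B" for y
    proof -
      have "\<bar>V y\<bar> * w y \<le> \<bar>V y\<bar> * 1" using w(3) by (intro mult_left_mono) auto
      then show ?thesis using B[of y] w(2)[of y] by (simp add: abs_mult)
    qed
    show "V y * w y = 0 \<or> (\<exists>k. in_gap m t k y \<and> (-1) ^ k * (V y * w y) \<ge> 0)" for y
    proof (cases "V y = 0")
      case False
      then obtain k where k: "in_gap m t k y" "(-1) ^ k * V y \<ge> 0" using V_sign by blast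
      have "(-1) ^ k * V y * w y \<ge> 0" using k(2) w(2) by (rule mult_nonneg_nonneg)
      then show ?thesis using k(1) by (auto simp: mult.assoc)
    qed simp
  qed
  have fw_int: "integrable lborel (\<lambda>y. f i y * (V y * w y))" if w: "continuous_on UNIV w" for i w
  proof -
    have "integrable lborel (\<lambda>y. f i y *\<^sub>R (V y * w y))"
    proof (rule integrable_scaleR_continuous[OF f_int])
      show "f i y = 0" if "y \<notin> {x i + a..x i - a}" for y
        using that f_zero[of y i] by auto
      show "continuous_on UNIV (\<lambda>y. V y * w y)" using V_cont w by (intro continuous_intros)
    qed
    then show ?thesis by simp
  qed
  have "(\<integral>y. f i y * (V y * g y) \<partial>lborel) + (\<integral>y. f i y * (V y * (1 - g y)) \<partial>lborel) =
      (\<integral>y. f i y * V y \<partial>lborel)" for i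
  proof -
    have "(\<integral>y. f i y * (V y * g y) \<partial>lborel) + (\<integral>y. f i y * (V y * (1 - g y)) \<partial>lborel) =
        (\<integral>y. f i y * (V y * g y) + f i y * (V y * (1 - g y)) \<partial>lborel)"
      by (intro Bochner_Integration.integral_add[symmetric] fw_int g_cont continuous_intros)
    then show ?thesis by (simp add: algebra_simps)
  qed
  then have "(\<Sum>i\<le>m. c i * (\<integral>y. f i y * (V y * g y) \<partial>lborel)) +
      (\<Sum>i\<le>m. c i * (\<integral>y. f i y * (V y * (1 - g y)) \<partial>lborel)) =
      (\<Sum>i\<le>m. c i * (\<integral>y. f i y * V y \<partial>lborel))"
    unfolding sum.distrib[symmetric] by (intro sum.cong refl) (simp only: distrib_left[symmetric])
  also have "\<dots> = 0" using fV by simp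
  finally have "(\<Sum>i\<le>m. c i * (\<integral>y. f i y * (V y * g y) \<partial>lborel)) = 0"
    using weighted[OF g_cont g01] weighted[of "\<lambda>y. 1 - g y"] g01
      continuous_on_diff[OF continuous_on_const[of UNIV 1] g_cont] by simp
  also have "(\<Sum>i\<le>m. c i * (\<integral>y. f i y * (V y * g y) \<partial>lborel)) =
      (\<Sum>i\<in>{j}. c i * (\<integral>y. f i y * (V y * g y) \<partial>lborel))"
  proof (rule sum.mono_neutral_right)
    show "\<forall>i\<in>{..m} - {j}. c i * (\<integral>y. f i y * (V y * g y) \<partial>lborel) = 0"
    proof
      fix i assume i: "i \<in> {..m} - {j}"
      show "c i * (\<integral>y. f i y * (V y * g y) \<partial>lborel) = 0"
      proof (cases "i < j")
        case False
        then have ji: "j < i" using i by simp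
        \<comment> \<open>\<open>g\<close> vanishes from \<open>u j\<close> on, and
          \<open>f i\<close> vanishes before \<open>l i\<close>, which is at least
          \<open>u j\<close>.\<close>
        have "f i y * (V y * g y) = 0" for y
          using g_zero[of y] f_zero[of y i] ul[OF ji] by (cases "y < u j") (auto simp: l_def)
        then show ?thesis by (simp only: Bochner_Integration.integral_zero mult_zero_right)
      qed (use c_below in simp)
    qed
  qed (use j in auto)
  finally have "(\<integral>y. f j y * (V y * g y) \<partial>lborel) = 0" using j(2) by simp
  moreover have "(\<integral>y. f j y * (V y * g y) \<partial>lborel) > 0"
  proof (rule integral_pos_of_pos_on_interval[OF fw_int[OF g_cont] _ lu[of j]])
    show P: "f j y * (V y * g y) > 0" if "l j < y" "y < u j" for y
    proof (intro mult_pos_pos g_pos that f_pos)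
      show "x j + a < y" "y < x j - a" using that \<eta>_le M(4) by (simp_all add: l_def u_def a_def)
      have y: "0 < y - a" "y - a < d"
        using that x_pos[of j] x_le[OF j(1)] M(3) \<eta>(1) by (simp_all add: l_def u_def)
      have "1 * d \<le> real p * d" using d(1) p by (intro mult_right_mono) auto
      then have "y \<le> b" using y unfolding b_def by linarith
      then have "V y = e y" using y by (intro V_eq) simp_all
      moreover have "sin (\<tau> * (y - a)) > 0"
        using y \<tau>(1) mult_strict_left_mono[OF y(2) \<tau>(1)] by (intro sin_gt_zero) (simp_all add: d_def)
      ultimately show "V y > 0" by (simp add: e_def)
    qed
    show "f j y * (V y * g y) \<ge> 0" for y
      using P[of y] g_zero[of y] by (cases "l j < y \<and> y < u j") (auto simp: less_imp_le)
  qed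
  ultimately show False by simp
qed

theorem theoremD:
  fixes \<rho> \<epsilon> :: real and \<rho>t :: ereal and p :: nat and \<Lambda> :: "real \<Rightarrow> real"
  assumes "0 < \<rho>" and "ereal \<rho> \<le> \<rho>t"
    and "0 < \<epsilon>" and "ereal \<epsilon> \<le> \<rho>t - ereal (\<rho>/2)"
    and "p \<ge> 2"
    and "set_integrable lborel {x. - \<rho>t < ereal x \<and> ereal x < \<rho>t} \<Lambda>"
    and "\<And>x. - \<rho>/2 < x \<Longrightarrow> x < \<rho>/2 \<Longrightarrow> \<Lambda> x > 0"
    and "\<And>x. - \<rho>t < ereal x \<Longrightarrow> ereal x < \<rho>t \<Longrightarrow> x \<notin> {-\<rho>/2..\<rho>/2} \<Longrightarrow> \<Lambda> x = 0"
    and "TN p {0..<\<epsilon>} {-\<rho>/2<..<\<rho>/2+\<epsilon>} (\<lambda>x y. \<Lambda> (x - y))"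
  shows "\<forall>s::complex. \<bar>Im s\<bar> < real p * pi / \<rho> \<longrightarrow> BL \<rho> \<Lambda> s \<noteq> 0"
proof (intro allI impI notI)
  fix s :: complex
  assume s: "\<bar>Im s\<bar> < real p * pi / \<rho>" and BL0: "BL \<rho> \<Lambda> s = 0"
  define D where "D = {x. - \<rho>t < ereal x \<and> ereal x < \<rho>t}"
  \<comment> \<open>Extension by zero: \<Lambda> is a total function, and its values outside
    \<open>D\<close> are arbitrary.\<close>
  define L where "L x = indicator D x * \<Lambda> x" for x
  \<comment> \<open>The differences of points from the two windows in the \<open>TN\<close>
    hypothesis fill exactly this range, and the upper bound on \<epsilon> places it inside
    \<open>D\<close>.\<close>
  have D: "x \<in> D" if "- (\<rho>/2 + \<epsilon>) < x" "x < \<rho>/2 + \<epsilon>" for x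
    using that assms(2,4) by (cases \<rho>t) (auto simp: D_def)
  have L_eq: "L x = \<Lambda> x" if "- (\<rho>/2 + \<epsilon>) < x" "x < \<rho>/2 + \<epsilon>" for x
    using D[OF that] by (simp add: L_def)
  have int: "integrable lborel L"
    using assms(6) by (simp add: set_integrable_def L_def[abs_def] D_def)
  have pos: "L x > 0" if "-\<rho>/2 < x" "x < \<rho>/2" for x
    using assms(7)[OF that] L_eq[of x] that assms(3) by simp
  have zero: "L x = 0" if "x \<notin> {-\<rho>/2..\<rho>/2}" for x
    using assms(8)[of x] that by (auto simp: L_def D_def indicator_def)
  \<comment> \<open>The absolute value makes \<tau> positive for every non-real \<open>s\<close>;
    the sign of \<open>Im s\<close> reappears only as a factor in \<open>ImE\<close>.\<close>
  define \<sigma> \<tau> where "\<sigma> = Re s" and "\<tau> = \<bar>Im s\<bar>"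
  define E where "E x = exp (- s * complex_of_real x)" for x
  have E_int: "integrable lborel (\<lambda>x. L x *\<^sub>R E x)"
    unfolding E_def by (intro integrable_scaleR_continuous[OF int zero] continuous_intros)
  have "BL \<rho> \<Lambda> s = (\<integral>x. indicator {-\<rho>/2<..<\<rho>/2} x *\<^sub>R (E x * complex_of_real (\<Lambda> x)) \<partial>lborel)"
    using assms(1) by (simp add: BL_def interval_lebesgue_integral_def set_lebesgue_integral_def E_def)
  also have "\<dots> = (\<integral>x. L x *\<^sub>R E x \<partial>lborel)"
  proof (rule Bochner_Integration.integral_cong_AE)
    have [measurable]: "L \<in> borel_measurable borel" using int by (simp add: borel_measurable_integrable)
    have [measurable]: "E \<in> borel_measurable borel"
      unfolding E_def by (intro borel_measurable_continuous_onI continuous_intros)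
    have eq: "indicator {-\<rho>/2<..<\<rho>/2} x *\<^sub>R (E x * complex_of_real (\<Lambda> x)) =
        indicator {-\<rho>/2<..<\<rho>/2} x *\<^sub>R (L x *\<^sub>R E x)" for x
      using L_eq[of x] assms(3) by (auto simp: indicator_def scaleR_conv_of_real)
    show "(\<lambda>x. indicator {-\<rho>/2<..<\<rho>/2} x *\<^sub>R (E x * complex_of_real (\<Lambda> x))) \<in> borel_measurable lborel"
      unfolding eq by measurable
    show "(\<lambda>x. L x *\<^sub>R E x) \<in> borel_measurable lborel" by measurable
    \<comment> \<open>At the two end points \<open>L\<close> may be nonzero, so the integrands agree
      only almost everywhere.\<close>
    have "AE x in lborel. x \<noteq> -\<rho>/2" "AE x in lborel. x \<noteq> \<rho>/2" by (rule AE_lborel_singleton)+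
    then show "AE x in lborel. indicator {-\<rho>/2<..<\<rho>/2} x *\<^sub>R (E x * complex_of_real (\<Lambda> x)) = L x *\<^sub>R E x"
    proof eventually_elim
      case (elim x)
      then have "L x = 0" if "x \<notin> {-\<rho>/2<..<\<rho>/2}"
        using that by (intro zero) auto
      then show ?case unfolding eq by (auto simp: indicator_def)
    qed
  qed
  finally have I0: "(\<integral>x. L x *\<^sub>R E x \<partial>lborel) = 0" using BL0 by simp
  have ReE: "Re (L x *\<^sub>R E x) = L x * (exp (- \<sigma> * x) * cos (\<tau> * x))" for x
    by (auto simp: E_def \<sigma>_def \<tau>_def Re_exp abs_if)
  have ImE: "Im (L x *\<^sub>R E x) = - sgn (Im s) * (L x * (exp (- \<sigma> * x) * sin (\<tau> * x)))" for x
    by (auto simp: E_def \<sigma>_def \<tau>_def Im_exp abs_if sgn_if)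
  have cos0: "(\<integral>x. L x * (exp (- \<sigma> * x) * cos (\<tau> * x)) \<partial>lborel) = 0"
    using integral_Re[OF E_int] I0 by (simp only: ReE) simp
  have sin0: "sgn (Im s) * (\<integral>x. L x * (exp (- \<sigma> * x) * sin (\<tau> * x)) \<partial>lborel) = 0"
    using integral_Im[OF E_int] I0 by (simp only: ImE integral_mult_right_zero) simp
  show False
  proof (cases "Im s = 0")
    case True
    \<comment> \<open>For real \<open>s\<close> the integrand is positive on the open interval,
      which already excludes a zero. The indicator removes the end points, where the sign of
      \<open>L\<close> is unknown.\<close>
    define g where "g x = indicator {-\<rho>/2<..<\<rho>/2} x * (L x * exp (- \<sigma> * x))" for x
    have Lint: "integrable lborel (\<lambda>x. L x * exp (- \<sigma> * x))"
    proof -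
      have "integrable lborel (\<lambda>x. L x *\<^sub>R exp (- \<sigma> * x))"
        by (intro integrable_scaleR_continuous[OF int zero] continuous_intros)
      then show ?thesis by simp
    qed
    have "integrable lborel g"
      unfolding g_def using integrable_mult_indicator[OF _ Lint, of "{-\<rho>/2<..<\<rho>/2}"] by simp
    then have "(\<integral>x. g x \<partial>lborel) > 0"
      by (rule integral_pos_of_pos_on_interval[where a = "-\<rho>/2" and b = "\<rho>/2"])
        (use pos assms(1) in \<open>auto simp: g_def indicator_def less_imp_le\<close>)
    also have "(\<integral>x. g x \<partial>lborel) = (\<integral>x. L x * exp (- \<sigma> * x) \<partial>lborel)"
    proof (rule Bochner_Integration.integral_cong_AE)
      have "AE x in lborel. x \<noteq> -\<rho>/2" "AE x in lborel. x \<noteq> \<rho>/2" by (rule AE_lborel_singleton)+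
      then show "AE x in lborel. g x = L x * exp (- \<sigma> * x)"
      proof eventually_elim
        case (elim x)
        then have "L x = 0" if "x \<notin> {-\<rho>/2<..<\<rho>/2}"
          using that by (intro zero) auto
        then show ?case by (auto simp: g_def indicator_def)
      qed
    qed (use \<open>integrable lborel g\<close> Lint in \<open>auto dest: borel_measurable_integrable\<close>)
    finally show False using cos0 True by (simp add: \<tau>_def)
  next
    case False
    show False
    proof (rule laplace_zero_contradiction[OF assms(1,3) _ int pos zero _ _ _ cos0])
      show "1 \<le> p" using assms(5) by simp
      show "0 < \<tau>" using False by (simp add: \<tau>_def)
      show "\<tau> * \<rho> < real p * pi" using s assms(1) by (simp add: \<tau>_def field_simps)
      show "(\<integral>x. L x * (exp (- \<sigma> * x) * sin (\<tau> * x)) \<partial>lborel) = 0"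
        using sin0 False by (simp add: sgn_if split: if_splits)
      fix x y assume x: "x \<in> inc {0..<\<epsilon>} p" and y: "y \<in> inc {-\<rho>/2<..<\<rho>/2+\<epsilon>} p"
      have "fdet p (\<lambda>i j. L (x i - y j)) = fdet p (\<lambda>i j. \<Lambda> (x i - y j))"
      proof (rule fdet_cong)
        fix i j assume "i < p" "j < p"
        then have "x i \<in> {0..<\<epsilon>}" "y j \<in> {-\<rho>/2<..<\<rho>/2+\<epsilon>}" using x y by (auto simp: inc_def)
        then show "L (x i - y j) = \<Lambda> (x i - y j)" by (intro L_eq) auto
      qed
      also have "\<dots> \<ge> 0"
        using assms(5,9) x y by (simp add: TN_def)
      finally show "fdet p (\<lambda>i j. L (x i - y j)) \<ge> 0" .
    qed
  qed
qed

end
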